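(* Fix $0<\alpha<\infty$ and $0<p<\infty$. If $f\in A^p_\alpha$, then for every $w\in\mathbb{D}$ the function $T_{w,\alpha/p}f$ also belongs to $A^p_\alpha$, and $$\|f\|_{\alpha,p}=\|T_{w,\alpha/p}f\|_{\alpha,p}.$$
   Context: $\mathbb{D}$ is the open unit disc in $\mathbb{C}$. For $f$ analytic in $\mathbb{D}$, $0<p<\infty$ and $0<r<1$, set $M_p^p(r,f)=\int_0^{2\pi}|f(re^{i\theta})|^p\,\frac{d\theta}{2\pi}$; the function $r\mapsto M_p^p(r,f)$ is increasing and differentiable on $(0,1)$. For $0<\alpha,p<\infty$ define $$\|f\|_{\alpha,p}^p=|f(0)|^p+\int_0^1\left(\frac{d}{dr}M_p^p(r,f)\right)(1-r^2)^{\alpha-1}\,dr\in[0,\infty],$$ and let $A^p_\alpha$ be the class of all analytic functions $f$ in $\mathbb{D}$ with $\|f\|_{\alpha,p}<\infty$. For $w\in\mathbb{D}$, $\kappa>0$ and $f$ analytic in $\mathbb{D}$, $$T_{w,\kappa}f(z)=f\left(\frac{w-z}{1-\overline{w}z}\right)\frac{(1-|w|^2)^\kappa}{(1-\overline{w}z)^{2\kappa}},$$ where powers of $1-\overline{w}z$ (which has positive real part) are taken with the principal branch. *)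

theory Defs
  imports "HOL-Analysis.Analysis"
begin

text \<open>\<open>mean_pow p r f\<close> is the \<open>p\<close>-th power $M_p^p(r,f)$ of the integral mean, not the mean itself.\<close>

definition mean_pow :: "real \<Rightarrow> real \<Rightarrow> (complex \<Rightarrow> complex) \<Rightarrow> real" where
  "mean_pow p r f =
     (LBINT \<theta>:{0..2 * pi}. norm (f (of_real r * exp (\<i> * of_real \<theta>))) powr p / (2 * pi))"

text \<open>
  For analytic \<open>f\<close> the derivative below exists on $(0,1)$ and is nonnegative, so that
  \<open>ennreal\<close>, which sends negative numbers to 0, does not change the integrand.
\<close>

definition A_norm_pow :: "real \<Rightarrow> real \<Rightarrow> (complex \<Rightarrow> complex) \<Rightarrow> ennreal" where
  "A_norm_pow \<alpha> p f =
     ennreal (norm (f 0) powr p) +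
     (\<integral>\<^sup>+ r\<in>{0<..<1}. ennreal (deriv (\<lambda>s. mean_pow p s f) r * (1 - r\<^sup>2) powr (\<alpha> - 1)) \<partial>lborel)"

text \<open>The \<open>p\<close>-th root of \<open>A_norm_pow\<close>; there is no \<open>powr\<close> on \<^typ>\<open>ennreal\<close>.\<close>

definition A_norm :: "real \<Rightarrow> real \<Rightarrow> (complex \<Rightarrow> complex) \<Rightarrow> ennreal" where
  "A_norm \<alpha> p f =
     (if A_norm_pow \<alpha> p f = \<infinity> then \<infinity>
      else ennreal (enn2real (A_norm_pow \<alpha> p f) powr (1 / p)))"

definition A_space :: "real \<Rightarrow> real \<Rightarrow> (complex \<Rightarrow> complex) set" where
  "A_space \<alpha> p = {f. f holomorphic_on ball 0 1 \<and> A_norm \<alpha> p f < \<infinity>}"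

definition T_op :: "complex \<Rightarrow> real \<Rightarrow> (complex \<Rightarrow> complex) \<Rightarrow> complex \<Rightarrow> complex" where
  "T_op w \<kappa> f z =
     f ((w - z) / (1 - cnj w * z)) *
     (of_real ((1 - (norm w)\<^sup>2) powr \<kappa>) / (1 - cnj w * z) powr of_real (2 * \<kappa>))"

end

theory Submission
  imports Defs "HOL-Complex_Analysis.Conformal_Mappings"
begin

text \<open>
  Write \<open>u = |f|\<^sup>p\<close>, let \<open>M\<close> be the mean of \<open>u\<close> over the circle of radius \<open>r\<close>, and put
  \<open>I(\<rho>) = M(0) + \<integral>\<^sub>0\<^sup>\<rho> M'(r) (1 - r\<^sup>2)\<^sup>\<alpha>\<^sup>-\<^sup>1 dr\<close>. Since \<open>M\<close> is increasing, the \<open>p\<close>-th power of the norm of \<open>f\<close> is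
  the supremum of \<open>I(\<rho>)\<close> over \<open>\<rho> < 1\<close>. An integration by parts removes the derivative of \<open>M\<close> from
  \<open>I(\<rho>)\<close>, so that \<open>I(\<rho>)\<close> makes sense for every continuous \<open>u\<close>, is linear in \<open>u\<close>, and passes to
  limits. The operator acts on \<open>u\<close> as the weighted pullback \<open>(u \<circ> \<phi>) |\<phi>'|\<^sup>\<alpha>\<close>. After a rotation only the
  automorphisms \<open>\<phi>\<^sub>t(z) = (z + t) / (1 + t z)\<close> with \<open>0 \<le> t < 1\<close> matter.

  The core is a flow argument. Along \<open>t\<close> the pullback \<open>U\<^sub>t\<close> of \<open>u\<close> solves a transport equation whose
  right-hand side, inserted into \<open>I(\<rho>)\<close>, is a total derivative in \<open>r\<close>; what is left is a boundary
  term with the factor \<open>(1 - \<rho>\<^sup>2)\<^sup>\<alpha>\<close> (lemma \<open>wint_divergence\<close>). If \<open>u\<close> is smooth up to the unit circle,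
  the rest of that term is bounded, hence \<open>I(\<rho>)\<close> changes along the flow by an amount that vanishes as
  \<open>\<rho> \<rightarrow> 1\<close> (lemma \<open>wint_pull_le\<close>).

  A general \<open>u = |f|\<^sup>p\<close> is replaced by \<open>(|f(R z)|\<^sup>2 + \<delta>\<^sup>2)\<^sup>p\<^sup>/\<^sup>2\<close> with \<open>R < 1\<close> and \<open>\<delta> > 0\<close>. For this function and its
  pullbacks, which are powers of \<open>|g|\<^sup>2 + |h|\<^sup>2\<close> with \<open>g\<close>, \<open>h\<close> holomorphic, the Laplacian is nonnegative, and
  therefore \<open>r M'(r)\<close> is nonnegative and increasing (lemma \<open>pair_cmean\<close>). So \<open>I(\<rho>)\<close> is increasing in
  \<open>\<rho>\<close>, a dilation by \<open>R\<close> does not increase it, and the part of the integral close to \<open>r = 1\<close> is small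
  uniformly in \<open>\<delta>\<close>. Letting \<open>\<delta> \<rightarrow> 0\<close> and then \<open>R \<rightarrow> 1\<close> shows that the operator does not increase the norm.
  Since it is an involution up to a unimodular constant, it preserves the norm.
\<close>

section \<open>Radial functions integrated against the weight\<close>

text \<open>
  The functional \<open>M(0) + \<integral>\<^sub>0\<^sup>\<rho> M'(r) (1 - r\<^sup>2)\<^sup>\<alpha>\<^sup>-\<^sup>1 dr\<close> of a radial function \<open>M\<close>, integrated by parts so that it
  is defined for every continuous \<open>M\<close>; see \<open>wint_has_integral\<close>.
\<close>

definition wint :: "real \<Rightarrow> (real \<Rightarrow> real) \<Rightarrow> real \<Rightarrow> real" where
  "wint \<alpha> M \<rho> = (1 - \<rho>\<^sup>2) powr (\<alpha> - 1) * M \<rho>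
     + 2 * (\<alpha> - 1) * integral {0..\<rho>} (\<lambda>r. M r * (r * (1 - r\<^sup>2) powr (\<alpha> - 2)))"

lemma one_minus_sq_pos: "0 \<le> r \<Longrightarrow> r \<le> \<rho> \<Longrightarrow> \<rho> < 1 \<Longrightarrow> 0 < 1 - (r::real)\<^sup>2"
  by (simp add: power_less_one_iff abs_square_less_1)

lemma has_field_derivative_weight:
  assumes "0 \<le> r" "r < 1"
  shows "((\<lambda>r. (1 - r\<^sup>2) powr b) has_real_derivative - (2 * b * (r * (1 - r\<^sup>2) powr (b - 1)))) (at r within S)"
proof -
  have "0 < 1 - r\<^sup>2" using one_minus_sq_pos[of r r] assms by simp
  then show ?thesis
    by (auto intro!: derivative_eq_intros simp: powr_diff field_simps)
qed

lemma continuous_on_weight: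
  assumes "\<rho> < 1"
  shows "continuous_on {0..\<rho>} (\<lambda>r::real. (1 - r\<^sup>2) powr b)"
  using assms one_minus_sq_pos[of _ \<rho>] by (intro continuous_intros) force+

lemma wint_has_integral:
  assumes \<rho>: "0 \<le> \<rho>" "\<rho> < 1" and M: "continuous_on {0..\<rho>} M" and C: "finite C"
    and D: "\<And>r. r \<in> {0<..<\<rho>} - C \<Longrightarrow> (M has_real_derivative M' r) (at r)"
  shows "((\<lambda>r. M' r * (1 - r\<^sup>2) powr (\<alpha> - 1)) has_integral (wint \<alpha> M \<rho> - M 0)) {0..\<rho>}"
proof -
  let ?F = "\<lambda>r. M r * (1 - r\<^sup>2) powr (\<alpha> - 1)"
  let ?g = "\<lambda>r. M r * (r * (1 - r\<^sup>2) powr (\<alpha> - 2))"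
  let ?d = "\<lambda>r. M' r * (1 - r\<^sup>2) powr (\<alpha> - 1) - 2 * (\<alpha> - 1) * ?g r"
  have 1: "(?d has_integral (?F \<rho> - ?F 0)) {0..\<rho>}"
  proof (rule fundamental_theorem_of_calculus_interior_strong[OF C \<rho>(1)])
    fix r assume r: "r \<in> {0<..<\<rho>} - C"
    have "((\<lambda>r. (1 - r\<^sup>2) powr (\<alpha> - 1)) has_real_derivative - (2 * (\<alpha>-1) * (r * (1 - r\<^sup>2) powr (\<alpha>-2)))) (at r)"
      using has_field_derivative_weight[of r "\<alpha> - 1"] r \<rho> by simp
    from DERIV_mult[OF D[OF r] this]
    show "(?F has_vector_derivative ?d r) (at r)"
      unfolding has_real_derivative_iff_has_vector_derivative[symmetric]
      by (simp add: algebra_simps)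
  next
    show "continuous_on {0..\<rho>} ?F"
      by (intro continuous_intros M continuous_on_weight \<rho>)
  qed
  have "?g integrable_on {0..\<rho>}"
    by (intro integrable_continuous_interval continuous_intros M continuous_on_weight \<rho>)
  then have "((\<lambda>r. 2 * (\<alpha> - 1) * ?g r) has_integral (2 * (\<alpha> - 1) * integral {0..\<rho>} ?g)) {0..\<rho>}"
    by (intro has_integral_mult_right) (rule integrable_integral)
  from has_integral_add[OF 1 this] show ?thesis
    by (simp add: wint_def algebra_simps)
qed

lemma wint_mono:
  assumes \<rho>: "0 \<le> \<rho>" "\<rho> \<le> \<sigma>" "\<sigma> < 1" and M: "continuous_on {0..<1} M" and C: "\<And>\<sigma>. \<sigma> < 1 \<Longrightarrow> finite (C \<inter> {0..\<sigma>})"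
    and D: "\<And>r. r \<in> {0<..<1} - C \<Longrightarrow> (M has_real_derivative M' r) (at r)"
    and nn: "\<And>r. r \<in> {0<..<1} - C \<Longrightarrow> 0 \<le> M' r"
  shows "wint \<alpha> M \<rho> \<le> wint \<alpha> M \<sigma>"
proof -
  let ?M = "\<lambda>r. if r \<in> {0<..<1} - C then M' r else 0"
  have I: "((\<lambda>r. ?M r * (1 - r\<^sup>2) powr (\<alpha> - 1)) has_integral (wint \<alpha> M t - M 0)) {0..t}" if "0 \<le> t" "t < 1" for t
    by (rule wint_has_integral[where C="C \<inter> {0..t}"]) (use that M C D in \<open>auto elim!: continuous_on_subset\<close>)
  have "wint \<alpha> M \<rho> - M 0 \<le> wint \<alpha> M \<sigma> - M 0"
    by (rule has_integral_subset_le[OF _ I I]) (use \<rho> nn in auto)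
  then show ?thesis by simp
qed

lemma wint_le_wint:
  assumes \<rho>: "0 \<le> \<rho>" "\<rho> < 1"
    and M: "continuous_on {0..\<rho>} M" and N: "continuous_on {0..\<rho>} N" and 0: "M 0 = N 0"
    and D: "\<And>r. r \<in> {0<..<\<rho>} \<Longrightarrow> (M has_real_derivative M' r) (at r)"
    and E: "\<And>r. r \<in> {0<..<\<rho>} \<Longrightarrow> (N has_real_derivative N' r) (at r)"
    and le: "\<And>r. r \<in> {0<..<\<rho>} \<Longrightarrow> M' r \<le> N' r"
  shows "wint \<alpha> M \<rho> \<le> wint \<alpha> N \<rho>"
proof -
  let ?M = "\<lambda>r. if r \<in> {0<..<\<rho>} then M' r else 0" and ?N = "\<lambda>r. if r \<in> {0<..<\<rho>} then N' r else 0"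
  have "((\<lambda>r. ?M r * (1 - r\<^sup>2) powr (\<alpha> - 1)) has_integral (wint \<alpha> M \<rho> - M 0)) {0..\<rho>}"
    by (rule wint_has_integral[where C="{}"]) (use \<rho> M D in auto)
  moreover have "((\<lambda>r. ?N r * (1 - r\<^sup>2) powr (\<alpha> - 1)) has_integral (wint \<alpha> N \<rho> - N 0)) {0..\<rho>}"
    by (rule wint_has_integral[where C="{}"]) (use \<rho> N E in auto)
  ultimately have "wint \<alpha> M \<rho> - M 0 \<le> wint \<alpha> N \<rho> - N 0"
    by (rule has_integral_le) (use le in \<open>auto intro!: mult_right_mono\<close>)
  then show ?thesis using 0 by simp
qed

text \<open>
  If \<open>r M'(r) \<le> k\<close>, then the contribution of \<open>[\<rho>, \<sigma>]\<close> is bounded above independently of \<open>\<sigma>\<close>: the weight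
  \<open>r (1 - r\<^sup>2)\<^sup>\<alpha>\<^sup>-\<^sup>1\<close> is integrable up to 1, since \<open>\<alpha> > 0\<close>.
\<close>

lemma wint_tail:
  assumes \<alpha>: "0 < \<alpha>" and \<rho>: "0 < \<rho>" "\<rho> \<le> \<sigma>" "\<sigma> < 1" and M: "continuous_on {0..<1} M"
    and D: "\<And>r. r \<in> {0<..<1} \<Longrightarrow> (M has_real_derivative M' r) (at r)"
    and le: "\<And>r. r \<in> {0<..<1} \<Longrightarrow> r * M' r \<le> k" and k: "0 \<le> k"
  shows "wint \<alpha> M \<sigma> \<le> wint \<alpha> M \<rho> + k * (1 - \<rho>\<^sup>2) powr \<alpha> / (2 * \<alpha> * \<rho>\<^sup>2)"
proof -
  let ?g = "\<lambda>r. M' r * (1 - r\<^sup>2) powr (\<alpha> - 1)"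
  let ?h = "\<lambda>r. k / \<rho>\<^sup>2 * (r * (1 - r\<^sup>2) powr (\<alpha> - 1))"
  have I: "(?g has_integral (wint \<alpha> M t - M 0)) {0..t}" if "0 \<le> t" "t < 1" for t
    by (rule wint_has_integral[where C="{}"]) (use that M D in \<open>auto elim!: continuous_on_subset\<close>)
  have gi: "?g integrable_on {0..\<sigma>}" using I[of \<sigma>] \<rho> by auto
  have "integral {0..\<rho>} ?g + integral {\<rho>..\<sigma>} ?g = integral {0..\<sigma>} ?g"
    by (rule Henstock_Kurzweil_Integration.integral_combine) (use \<rho> gi in auto)
  then have "integral {\<rho>..\<sigma>} ?g = wint \<alpha> M \<sigma> - wint \<alpha> M \<rho>"
    using I[of \<rho>] I[of \<sigma>] \<rho> by (auto dest!: integral_unique)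
  moreover have "?g integrable_on {\<rho>..\<sigma>}"
    by (rule integrable_subinterval_real[OF gi]) (use \<rho> in auto)
  ultimately have G: "(?g has_integral (wint \<alpha> M \<sigma> - wint \<alpha> M \<rho>)) {\<rho>..\<sigma>}"
    by (metis integrable_integral)
  let ?F = "\<lambda>r. - (k / \<rho>\<^sup>2 / (2 * \<alpha>) * (1 - r\<^sup>2) powr \<alpha>)"
  have H: "(?h has_integral (?F \<sigma> - ?F \<rho>)) {\<rho>..\<sigma>}"
  proof (rule fundamental_theorem_of_calculus[OF \<rho>(2)])
    fix r assume "r \<in> {\<rho>..\<sigma>}"
    then have r: "0 \<le> r" "r < 1" using \<rho> by auto
    show "(?F has_vector_derivative ?h r) (at r within {\<rho>..\<sigma>})"
      unfolding has_real_derivative_iff_has_vector_derivative[symmetric]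
      using \<alpha> DERIV_cmult[OF has_field_derivative_weight[OF r, of \<alpha>], of "- (k / \<rho>\<^sup>2 / (2 * \<alpha>))"]
      by (simp add: field_simps)
  qed
  have "wint \<alpha> M \<sigma> - wint \<alpha> M \<rho> \<le> ?F \<sigma> - ?F \<rho>"
  proof (rule has_integral_le[OF G H])
    fix r assume r: "r \<in> {\<rho>..\<sigma>}"
    have "\<rho>\<^sup>2 * M' r \<le> k * r"
    proof (cases "M' r \<le> 0")
      case True
      then show ?thesis using k r \<rho> by (smt (verit) atLeastAtMost_iff mult_nonneg_nonneg mult_nonneg_nonpos zero_le_power2)
    next
      case False
      have "\<rho>\<^sup>2 * M' r \<le> r\<^sup>2 * M' r" using False r \<rho> by (intro mult_right_mono power_mono) auto
      also have "\<dots> = (r * M' r) * r" by (simp add: power2_eq_square)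
      also have "\<dots> \<le> k * r" using le[of r] r \<rho> by (intro mult_right_mono) auto
      finally show ?thesis .
    qed
    then have "M' r \<le> k / \<rho>\<^sup>2 * r" using \<rho> by (simp add: field_simps)
    from mult_right_mono[OF this, of "(1 - r\<^sup>2) powr (\<alpha> - 1)"]
    show "?g r \<le> ?h r" by (simp add: mult.assoc)
  qed
  also have "\<dots> \<le> - ?F \<rho>"
    using k \<alpha> by simp
  finally show ?thesis by (simp add: algebra_simps)
qed

lemma wint_tendsto:
  assumes \<rho>: "0 \<le> \<rho>" "\<rho> < 1" and c: "\<And>n::nat. continuous_on {0..\<rho>} (M n)"
    and B: "\<And>n r. r \<in> {0..\<rho>} \<Longrightarrow> \<bar>M n r\<bar> \<le> B"
    and lim: "\<And>r. r \<in> {0..\<rho>} \<Longrightarrow> (\<lambda>n. M n r) \<longlonglongrightarrow> N r"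
  shows "(\<lambda>n. wint \<alpha> (M n) \<rho>) \<longlonglongrightarrow> wint \<alpha> N \<rho>"
proof -
  have "(\<lambda>n. integral {0..\<rho>} (\<lambda>r. M n r * (r * (1 - r\<^sup>2) powr (\<alpha> - 2)))) \<longlonglongrightarrow>
     integral {0..\<rho>} (\<lambda>r. N r * (r * (1 - r\<^sup>2) powr (\<alpha> - 2)))"
  proof (rule dominated_convergence(2)[where h="\<lambda>r. B * (r * (1 - r\<^sup>2) powr (\<alpha> - 2))"])
    show "norm (M n r * (r * (1 - r\<^sup>2) powr (\<alpha> - 2))) \<le> B * (r * (1 - r\<^sup>2) powr (\<alpha> - 2))"
      if "r \<in> {0..\<rho>}" for n r
      using B[OF that, of n] that by (simp add: abs_mult mult_right_mono)
  qed (auto intro!: integrable_continuous_interval continuous_intros c continuous_on_weight \<rho> tendsto_intros lim)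
  then show ?thesis
    unfolding wint_def by (intro tendsto_intros lim) (use \<rho> in auto)
qed

section \<open>Circle means\<close>

text \<open>
  The mean of a real function over the circle of radius \<open>r\<close> about the origin.
\<close>

definition cmean :: "(complex \<Rightarrow> real) \<Rightarrow> real \<Rightarrow> real" where
  "cmean u r = integral {0..2 * pi} (\<lambda>\<theta>. u (of_real r * cis \<theta>)) / (2 * pi)"

text \<open>
  The real differential of \<open>u\<close> at \<open>z\<close> is \<open>h \<mapsto> Re (e h)\<close>. Thus \<open>e\<close> is twice the Wirtinger derivative
  \<open>\<partial>u/\<partial>z\<close>, that is, the conjugate of the gradient; the real parts of \<open>e z\<close> and \<open>e \<i> z\<close> are the radial
  derivative times \<open>|z|\<close> and the angular derivative.
\<close>

definition has_grad :: "(complex \<Rightarrow> real) \<Rightarrow> complex \<Rightarrow> complex \<Rightarrow> bool" where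
  "has_grad u e z \<longleftrightarrow> (u has_derivative (\<lambda>h. Re (e * h))) (at z)"

lemma cmean_cong: "(\<And>z. norm z = \<bar>r\<bar> \<Longrightarrow> u z = v z) \<Longrightarrow> cmean u r = cmean v r"
  by (simp add: cmean_def norm_mult)

lemma continuous_on_circle:
  assumes "continuous_on (ball 0 1) (u :: complex \<Rightarrow> 'a::topological_space)" "\<bar>r\<bar> < 1"
  shows "continuous_on S (\<lambda>\<theta>. u (of_real r * cis \<theta>))"
  by (rule continuous_on_compose2[OF assms(1)]) (use assms(2) in \<open>auto intro!: continuous_intros simp: norm_mult\<close>)

lemma integrable_circle:
  assumes "continuous_on (ball 0 1) (u :: complex \<Rightarrow> real)" "\<bar>r\<bar> < 1"
  shows "(\<lambda>\<theta>. u (of_real r * cis \<theta>)) integrable_on {0..2*pi}"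
  by (intro integrable_continuous_interval continuous_on_circle assms)

lemma cmean_diff:
  assumes "continuous_on (ball 0 1) u" "continuous_on (ball 0 1) v" "\<bar>r\<bar> < 1"
  shows "cmean (\<lambda>z. u z - v z) r = cmean u r - cmean v r"
  using assms by (simp add: cmean_def integral_diff integrable_circle diff_divide_distrib)

lemma cmean_cmult: "cmean (\<lambda>z. c * u z) r = c * cmean u r"
  by (simp add: cmean_def)

lemma cmean_const [simp]: "cmean (\<lambda>z. c) r = c"
  by (simp add: cmean_def)

lemma cmean_mono:
  assumes "continuous_on (ball 0 1) u" "continuous_on (ball 0 1) v" "\<bar>r\<bar> < 1"
    and "\<And>z. norm z = \<bar>r\<bar> \<Longrightarrow> u z \<le> v z"
  shows "cmean u r \<le> cmean v r"
  unfolding cmean_def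
  by (intro divide_right_mono integral_le integrable_circle assms) (auto simp: norm_mult)

lemma cmean_abs_le:
  assumes "continuous_on (ball 0 1) u" "\<bar>r\<bar> < 1" and "\<And>z. norm z = \<bar>r\<bar> \<Longrightarrow> \<bar>u z\<bar> \<le> B"
  shows "\<bar>cmean u r\<bar> \<le> B"
proof -
  have "cmean u r \<le> cmean (\<lambda>z. B) r" "cmean (\<lambda>z. - B) r \<le> cmean u r"
    by (intro cmean_mono assms continuous_intros; use assms(3) in force)+
  then show ?thesis by simp
qed

lemma cmean_0 [simp]: "cmean u 0 = u 0"
  by (simp add: cmean_def)

lemma continuous_on_cmean_param:
  fixes u :: "real \<Rightarrow> complex \<Rightarrow> real"
  assumes "continuous_on (X \<times> ball 0 1) (\<lambda>(x, z). u x z)"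
  shows "continuous_on (X \<times> {0..<1}) (\<lambda>(x, r). cmean (u x) r)"
proof -
  have "continuous_on ((X \<times> {0..<1}) \<times> cbox 0 (2*pi)) (\<lambda>(y, \<theta>). u (fst y) (of_real (snd y) * cis \<theta>))"
    unfolding split_beta
    by (rule continuous_on_compose2[OF assms[unfolded split_beta],
          where f="\<lambda>p. (fst (fst p), of_real (snd (fst p)) * cis (snd p))", simplified])
       (auto intro!: continuous_intros simp: norm_mult)
  from integral_continuous_on_param[OF this]
  show ?thesis by (auto simp: cmean_def split_beta intro!: continuous_intros)
qed

lemma continuous_on_cmean:
  assumes "continuous_on (ball 0 1) u"
  shows "continuous_on {0..<1} (cmean u)"
proof -
  have "continuous_on ({0} \<times> {0..<1}) (\<lambda>(x::real, r). cmean u r)"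
    by (rule continuous_on_cmean_param)
       (use assms in \<open>auto simp: split_beta intro!: continuous_on_compose2[OF assms] continuous_intros\<close>)
  from continuous_on_compose2[OF this, of "{0..<1}" "\<lambda>r. (0, r)"]
  show ?thesis by (force intro!: continuous_intros)
qed

lemma has_grad_path:
  assumes "has_grad u e (\<gamma> t)" "(\<gamma> has_vector_derivative d) (at t within S)"
  shows "((\<lambda>t. u (\<gamma> t)) has_real_derivative Re (e * d)) (at t within S)"
proof -
  have "(u has_derivative (\<lambda>h. Re (e * h))) (at (\<gamma> t) within \<gamma> ` S)"
    using assms(1) unfolding has_grad_def by (rule has_derivative_at_withinI)
  from diff_chain_within[OF assms(2)[unfolded has_vector_derivative_def] this]
  show ?thesis
    unfolding has_field_derivative_def o_def
    by (rule has_derivative_eq_rhs) (auto simp: fun_eq_iff algebra_simps)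
qed

lemma has_grad_continuous:
  assumes "\<And>z. z \<in> S \<Longrightarrow> has_grad u (e z) z"
  shows "continuous_on S u"
  using assms unfolding has_grad_def
  by (meson continuous_at_imp_continuous_on has_derivative_continuous)

lemma has_derivative_cmean:
  assumes r: "0 < r" "a < r" "r < b"
    and g: "\<And>z. a < norm z \<Longrightarrow> norm z < b \<Longrightarrow> has_grad u (e z) z"
    and c: "continuous_on {z. a < norm z \<and> norm z < b} e"
  shows "(cmean u has_real_derivative cmean (\<lambda>z. Re (e z * z)) r / r) (at r)"
proof -
  let ?A = "{z :: complex. a < norm z \<and> norm z < b}" and ?U = "{max a 0<..<b}"
  have uc: "continuous_on ?A u" using g by (intro has_grad_continuous) auto
  have "((\<lambda>x. integral (cbox 0 (2*pi)) (\<lambda>\<theta>. u (of_real x * cis \<theta>))) has_field_derivative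
     integral (cbox 0 (2*pi)) (\<lambda>\<theta>. Re (e (of_real r * cis \<theta>) * cis \<theta>))) (at r within ?U)"
  proof (rule leibniz_rule_field_derivative)
    fix x \<theta> :: real assume x: "x \<in> ?U"
    show "((\<lambda>x. u (of_real x * cis \<theta>)) has_real_derivative Re (e (of_real x * cis \<theta>) * cis \<theta>)) (at x within ?U)"
      by (rule has_grad_path) (use x in \<open>auto intro!: g derivative_eq_intros simp: norm_mult\<close>)
    show "(\<lambda>\<theta>. u (of_real x * cis \<theta>)) integrable_on cbox 0 (2*pi)"
      unfolding cbox_interval
      by (intro integrable_continuous_interval continuous_on_compose2[OF uc])
         (use x in \<open>auto intro!: continuous_intros simp: norm_mult\<close>)
  next
    show "continuous_on (?U \<times> cbox 0 (2 * pi)) (\<lambda>(x, \<theta>). Re (e (of_real x * cis \<theta>) * cis \<theta>))"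
      unfolding split_beta
      by (intro continuous_intros continuous_on_compose2[OF c]) (auto simp: norm_mult)
  qed (use r in auto)
  then have "((\<lambda>x. integral {0..2*pi} (\<lambda>\<theta>. u (of_real x * cis \<theta>))) has_real_derivative
     integral {0..2*pi} (\<lambda>\<theta>. Re (e (of_real r * cis \<theta>) * cis \<theta>))) (at r)"
    using at_within_open[of r ?U] r by (simp add: cbox_interval)
  from DERIV_cdivide[OF this, of "2*pi"]
  have "(cmean u has_real_derivative integral {0..2*pi} (\<lambda>\<theta>. Re (e (of_real r * cis \<theta>) * cis \<theta>)) / (2*pi)) (at r)"
    by (simp add: cmean_def[abs_def])
  moreover have "cmean (\<lambda>z. Re (e z * z)) r = r * (integral {0..2*pi} (\<lambda>\<theta>. Re (e (of_real r * cis \<theta>) * cis \<theta>)) / (2*pi))"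
    unfolding cmean_def times_divide_eq_right integral_mult_right[symmetric]
    by (intro arg_cong2[where f="(/)"] integral_cong refl) (simp add: algebra_simps)
  ultimately show ?thesis using r by simp
qed

lemma cmean_angular:
  assumes r: "0 \<le> r" and g: "\<And>z. norm z = r \<Longrightarrow> has_grad u (e z) z"
  shows "cmean (\<lambda>z. Re (e z * (\<i> * z))) r = 0"
proof -
  have "((\<lambda>\<theta>. Re (e (of_real r * cis \<theta>) * (\<i> * (of_real r * cis \<theta>)))) has_integral
     (u (of_real r * cis (2*pi)) - u (of_real r * cis 0))) {0..2*pi}"
  proof (rule fundamental_theorem_of_calculus)
    fix t assume "t \<in> {0..2*pi}"
    have "((\<lambda>\<theta>. of_real r * cis \<theta>) has_vector_derivative (\<i> * (of_real r * cis t))) (at t within {0..2*pi})"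
      unfolding cis_conv_exp
      by (rule has_vector_derivative_real_field) (auto intro!: derivative_eq_intros)
    from has_grad_path[OF _ this, of u "e (of_real r * cis t)"]
    show "((\<lambda>\<theta>. u (of_real r * cis \<theta>)) has_vector_derivative Re (e (of_real r * cis t) * (\<i> * (of_real r * cis t))))
       (at t within {0..2*pi})"
      using g[of "of_real r * cis t"] r by (simp add: norm_mult has_real_derivative_iff_has_vector_derivative)
  qed simp
  then show ?thesis by (simp add: cmean_def integral_unique)
qed

lemma cmean_rotate:
  assumes c: "continuous_on (ball 0 1) u" and r: "\<bar>r\<bar> < 1" and a: "norm a = 1"
  shows "cmean (\<lambda>z. u (a * z)) r = cmean u r"
proof -
  obtain \<phi> where \<phi>: "a = cis \<phi>" "0 \<le> \<phi>" "\<phi> < 2 * pi"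
  proof -
    from complex_norm_eq_1_exp[of a] a obtain t where t: "0 \<le> t" "t < 2*pi" "a = exp (\<i> * of_real t)"
      by (metis Arg2pi_eq complex_norm_eq_1_exp Arg2pi_ge_0 Arg2pi_lt_2pi)
    then show thesis using that by (simp add: cis_conv_exp)
  qed
  let ?g = "\<lambda>\<theta>. u (of_real r * cis \<theta>)"
  have gi: "?g integrable_on {x..y}" for x y
    by (intro integrable_continuous_interval continuous_on_circle c r)
  have per: "?g (\<theta> + 2 * pi) = ?g \<theta>" for \<theta>
    by (simp add: cis_mult[symmetric])
  have "integral {0..2*pi} (\<lambda>\<theta>. u (a * (of_real r * cis \<theta>))) = integral {0..2*pi} (\<lambda>\<theta>. ?g (\<theta> + \<phi>))"
    by (intro integral_cong) (simp add: \<phi> cis_mult[symmetric] mult_ac)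
  also have "\<dots> = integral {\<phi>..2*pi + \<phi>} ?g"
    using integral_shift_Icc_real[of 0 "2*pi" ?g \<phi>] by (simp add: add.commute o_def)
  also have "\<dots> = integral {\<phi>..2*pi} ?g + integral {2*pi..2*pi + \<phi>} ?g"
    by (rule Henstock_Kurzweil_Integration.integral_combine[symmetric]) (use \<phi> gi in auto)
  also have "integral {2*pi..2*pi + \<phi>} ?g = integral {0..\<phi>} ?g"
    using integral_shift_Icc_real[of 0 "\<phi>" ?g "2*pi"] per by (simp add: add.commute o_def)
  also have "integral {\<phi>..2*pi} ?g + integral {0..\<phi>} ?g = integral {0..2*pi} ?g"
    using Henstock_Kurzweil_Integration.integral_combine[of 0 \<phi> "2*pi" ?g] \<phi> gi by simp
  finally show ?thesis by (simp add: cmean_def)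
qed

lemma cmean_tendsto:
  assumes r: "\<bar>r\<bar> < 1" and c: "\<And>n::nat. continuous_on (ball 0 1) (u n)"
    and B: "\<And>n z. norm z = \<bar>r\<bar> \<Longrightarrow> \<bar>u n z\<bar> \<le> B"
    and lim: "\<And>z. norm z = \<bar>r\<bar> \<Longrightarrow> (\<lambda>n. u n z) \<longlonglongrightarrow> v z"
  shows "(\<lambda>n. cmean (u n) r) \<longlonglongrightarrow> cmean v r"
  unfolding cmean_def
proof (intro tendsto_divide tendsto_const)
  show "(\<lambda>n. integral {0..2*pi} (\<lambda>\<theta>. u n (of_real r * cis \<theta>))) \<longlonglongrightarrow> integral {0..2*pi} (\<lambda>\<theta>. v (of_real r * cis \<theta>))"
    by (rule dominated_convergence(2)[where h="\<lambda>_. B"])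
       (use r B lim in \<open>auto intro!: integrable_circle c simp: norm_mult\<close>)
qed simp

text \<open>
  Only pointwise convergence with a common bound is needed, because \<open>wint\<close> does not see derivatives.
\<close>

lemma wint_cmean_tendsto:
  assumes \<rho>: "0 \<le> \<rho>" "\<rho> < 1" and c: "\<And>n::nat. continuous_on (ball 0 1) (u n)"
    and B: "\<And>n z. norm z \<le> \<rho> \<Longrightarrow> \<bar>u n z\<bar> \<le> B"
    and lim: "\<And>z. norm z \<le> \<rho> \<Longrightarrow> (\<lambda>n. u n z) \<longlonglongrightarrow> v z"
  shows "(\<lambda>n. wint \<alpha> (cmean (u n)) \<rho>) \<longlonglongrightarrow> wint \<alpha> (cmean v) \<rho>"
proof (rule wint_tendsto[OF \<rho>])
  show "continuous_on {0..\<rho>} (cmean (u n))" for n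
    using continuous_on_cmean[OF c] by (rule continuous_on_subset) (use \<rho> in auto)
  show "\<bar>cmean (u n) r\<bar> \<le> B" if "r \<in> {0..\<rho>}" for n r
    by (rule cmean_abs_le) (use that \<rho> B c in auto)
  show "(\<lambda>n. cmean (u n) r) \<longlonglongrightarrow> cmean v r" if "r \<in> {0..\<rho>}" for r
    by (rule cmean_tendsto[where B=B]) (use that \<rho> B c lim in auto)
qed

lemma wint_cong: "0 \<le> \<rho> \<Longrightarrow> (\<And>r. 0 \<le> r \<Longrightarrow> r \<le> \<rho> \<Longrightarrow> M r = N r) \<Longrightarrow> wint \<alpha> M \<rho> = wint \<alpha> N \<rho>"
  unfolding wint_def by (intro arg_cong2[where f="(+)"] arg_cong2[where f="(*)"] integral_cong refl) auto

lemma has_derivative_cmean_param: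
  fixes u :: "real \<Rightarrow> complex \<Rightarrow> real"
  assumes X: "convex X" "x0 \<in> X" and r: "\<bar>r\<bar> < 1"
    and c: "\<And>x. x \<in> X \<Longrightarrow> continuous_on (ball 0 1) (u x)"
    and c': "continuous_on (X \<times> ball 0 1) (\<lambda>(x, z). u' x z)"
    and D: "\<And>x z. x \<in> X \<Longrightarrow> norm z < 1 \<Longrightarrow> ((\<lambda>x. u x z) has_real_derivative u' x z) (at x within X)"
  shows "((\<lambda>x. cmean (u x) r) has_real_derivative cmean (u' x0) r) (at x0 within X)"
proof -
  have "((\<lambda>x. integral (cbox 0 (2*pi)) (\<lambda>\<theta>. u x (of_real r * cis \<theta>))) has_field_derivative
     integral (cbox 0 (2*pi)) (\<lambda>\<theta>. u' x0 (of_real r * cis \<theta>))) (at x0 within X)"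
  proof (rule leibniz_rule_field_derivative[OF _ _ _ X(2,1)])
    show "continuous_on (X \<times> cbox 0 (2 * pi)) (\<lambda>(x, \<theta>). u' x (of_real r * cis \<theta>))"
      unfolding split_beta
      by (rule continuous_on_compose2[OF c'[unfolded split_beta],
          where f="\<lambda>p. (fst p, of_real r * cis (snd p))", simplified])
         (use r in \<open>auto intro!: continuous_intros simp: norm_mult\<close>)
  qed (use r c D integrable_circle in \<open>auto simp: norm_mult\<close>)
  from DERIV_cdivide[OF this, of "2*pi"] show ?thesis
    by (simp add: cmean_def)
qed

lemma has_derivative_wint_param:
  fixes u :: "real \<Rightarrow> complex \<Rightarrow> real"
  assumes X: "convex X" "x0 \<in> X" and \<rho>: "0 \<le> \<rho>" "\<rho> < 1"
    and c: "\<And>x. x \<in> X \<Longrightarrow> continuous_on (ball 0 1) (u x)"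
    and c': "continuous_on (X \<times> ball 0 1) (\<lambda>(x, z). u' x z)"
    and D: "\<And>x z. x \<in> X \<Longrightarrow> norm z < 1 \<Longrightarrow> ((\<lambda>x. u x z) has_real_derivative u' x z) (at x within X)"
  shows "((\<lambda>x. wint \<alpha> (cmean (u x)) \<rho>) has_real_derivative wint \<alpha> (cmean (u' x0)) \<rho>) (at x0 within X)"
proof -
  let ?w = "\<lambda>r. r * (1 - r\<^sup>2) powr (\<alpha> - 2)"
  note d = has_derivative_cmean_param[OF X(1) _ _ c c' D]
  have "((\<lambda>x. integral (cbox 0 \<rho>) (\<lambda>r. cmean (u x) r * ?w r)) has_field_derivative
     integral (cbox 0 \<rho>) (\<lambda>r. cmean (u' x0) r * ?w r)) (at x0 within X)"
  proof (rule leibniz_rule_field_derivative[OF _ _ _ X(2,1)])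
    show "((\<lambda>x. cmean (u x) r * ?w r) has_real_derivative cmean (u' x) r * ?w r) (at x within X)"
      if "x \<in> X" "r \<in> cbox 0 \<rho>" for x r
      by (rule DERIV_cmult_right, rule d) (use that \<rho> in auto)
    show "(\<lambda>r. cmean (u x) r * ?w r) integrable_on cbox 0 \<rho>" if "x \<in> X" for x
      unfolding cbox_interval
      by (intro integrable_continuous_interval continuous_intros continuous_on_weight \<rho>
          continuous_on_subset[OF continuous_on_cmean[OF c[OF that]]]) (use \<rho> in auto)
    have "continuous_on (X \<times> cbox 0 \<rho>) (\<lambda>p. cmean (u' (fst p)) (snd p))"
      using continuous_on_cmean_param[OF c'] unfolding split_beta
      by (rule continuous_on_subset) (use \<rho> in auto)
    moreover have "continuous_on (X \<times> cbox 0 \<rho>) (\<lambda>p. ?w (snd p))"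
      by (rule continuous_on_compose2[where g="?w" and t="{0..\<rho>}"])
        (auto intro!: continuous_intros continuous_on_weight \<rho>)
    ultimately show "continuous_on (X \<times> cbox 0 \<rho>) (\<lambda>(x, r). cmean (u' x) r * ?w r)"
      unfolding split_beta by (rule continuous_on_mult)
  qed
  then show ?thesis
    unfolding wint_def cbox_interval
    by (intro DERIV_add DERIV_cmult d X) (use \<rho> in auto)
qed

section \<open>Subharmonicity\<close>

lemma has_grad_cong_simp: "has_grad u e z \<Longrightarrow> e = e' \<Longrightarrow> has_grad u e' z"
  by simp

lemma has_grad_add: "has_grad u e z \<Longrightarrow> has_grad v d z \<Longrightarrow> has_grad (\<lambda>z. u z + v z) (e + d) z"
  unfolding has_grad_def by (drule (1) has_derivative_add) (simp add: distrib_right)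

lemma has_grad_const [simp]: "has_grad (\<lambda>z. c) 0 z"
  by (simp add: has_grad_def)

lemma has_grad_cmult: "has_grad u e z \<Longrightarrow> has_grad (\<lambda>z. c * u z) (of_real c * e) z"
  unfolding has_grad_def by (drule has_derivative_mult_right[of _ _ _ c]) (simp add: algebra_simps)

lemma has_grad_mult:
  "has_grad u e z \<Longrightarrow> has_grad v d z \<Longrightarrow> has_grad (\<lambda>z. u z * v z) (of_real (u z) * d + of_real (v z) * e) z"
  unfolding has_grad_def by (drule (1) has_derivative_mult) (simp add: algebra_simps)

lemma has_grad_powr:
  assumes "has_grad u e z" "0 < u z"
  shows "has_grad (\<lambda>z. u z powr q) (of_real (q * u z powr (q - 1)) * e) z"
proof -
  have "((\<lambda>x. x powr q) has_real_derivative q * u z powr (q - 1)) (at (u z))"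
    using has_real_derivative_powr[OF assms(2), of q] by simp
  from has_derivative_compose[OF assms(1)[unfolded has_grad_def] this[unfolded has_field_derivative_def]]
  show ?thesis unfolding has_grad_def
    by (rule has_derivative_eq_rhs) (simp add: fun_eq_iff algebra_simps)
qed

lemma has_grad_Re_cnj_mult:
  assumes "(g has_field_derivative d) (at z)" "(k has_field_derivative c) (at z)"
  shows "has_grad (\<lambda>z. Re (cnj (g z) * k z)) (cnj (k z) * d + cnj (g z) * c) z"
  unfolding has_grad_def
  using has_derivative_Re[OF has_derivative_mult[OF has_derivative_cnj assms(2)[unfolded has_field_derivative_def],
      OF assms(1)[unfolded has_field_derivative_def]]]
  by (rule has_derivative_eq_rhs) (simp add: fun_eq_iff algebra_simps)

lemma has_grad_Im_cnj_mult:
  assumes "(g has_field_derivative d) (at z)" "(k has_field_derivative c) (at z)"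
  shows "has_grad (\<lambda>z. Im (cnj (g z) * k z)) (\<i> * (cnj (k z) * d - cnj (g z) * c)) z"
  unfolding has_grad_def
  using has_derivative_Im[OF has_derivative_mult[OF has_derivative_cnj assms(2)[unfolded has_field_derivative_def],
      OF assms(1)[unfolded has_field_derivative_def]]]
  by (rule has_derivative_eq_rhs) (simp add: fun_eq_iff algebra_simps)

lemma has_grad_norm_sq:
  assumes "(g has_field_derivative d) (at z)"
  shows "has_grad (\<lambda>z. (norm (g z))\<^sup>2) (2 * cnj (g z) * d) z"
proof -
  have eq: "(\<lambda>z. Re (cnj (g z) * g z)) = (\<lambda>z. (norm (g z))\<^sup>2)"
    unfolding fun_eq_iff by (simp add: cmod_power2) (simp add: power2_eq_square)
  from has_grad_Re_cnj_mult[OF assms assms] show ?thesis unfolding eq by (simp add: mult_ac)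
qed

text \<open>
  Up to a positive factor this is the Laplacian of \<open>(|g|\<^sup>2 + |h|\<^sup>2)\<^sup>q\<close> at a point \<open>z \<noteq> 0\<close>, where \<open>a\<close>, \<open>b\<close> are the values of
  \<open>g\<close>, \<open>h\<close> and \<open>k\<close>, \<open>l\<close> those of \<open>z g'\<close>, \<open>z h'\<close>. For \<open>q < 1\<close> the negative term is controlled by the
  Cauchy-Schwarz inequality.
\<close>

lemma pair_laplacian_nonneg:
  fixes a b k l :: complex and q :: real
  assumes "0 < q" and s: "s = (norm a)\<^sup>2 + (norm b)\<^sup>2"
  shows "0 \<le> (q - 1) * (norm (cnj a * k + cnj b * l))\<^sup>2 + s * ((norm k)\<^sup>2 + (norm l)\<^sup>2)"
proof -
  have "norm (cnj a * k + cnj b * l) \<le> norm a * norm k + norm b * norm l"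
    by (metis norm_triangle_ineq norm_mult complex_mod_cnj)
  then have "(norm (cnj a * k + cnj b * l))\<^sup>2 \<le> (norm a * norm k + norm b * norm l)\<^sup>2"
    by (intro power_mono) auto
  also have "\<dots> \<le> s * ((norm k)\<^sup>2 + (norm l)\<^sup>2)"
    using sum_squares_ge_zero[of "norm a * norm l - norm b * norm k" 0]
    by (simp add: s power2_eq_square algebra_simps)
  finally have cs: "(norm (cnj a * k + cnj b * l))\<^sup>2 \<le> s * ((norm k)\<^sup>2 + (norm l)\<^sup>2)" .
  have "0 \<le> q * (norm (cnj a * k + cnj b * l))\<^sup>2" using assms by simp
  then show ?thesis using cs by (simp add: algebra_simps)
qed

text \<open>
  The function \<open>K(r) = r M'(r)\<close> of the circle mean \<open>M\<close> of \<open>(|g|\<^sup>2 + |h|\<^sup>2)\<^sup>q\<close> is nonnegative and increasing: this is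
  Hardy's convexity of \<open>M\<close> in \<open>ln r\<close>. Here \<open>K\<close> is the mean of \<open>P = r \<partial>\<^sub>r u\<close>; with \<open>\<partial>\<^sub>\<theta> u = - Q\<close>, the Laplacian of
  \<open>u = (|g|\<^sup>2 + |h|\<^sup>2)\<^sup>q\<close> times \<open>r\<^sup>2\<close> is \<open>r \<partial>\<^sub>r P - \<partial>\<^sub>\<theta> Q\<close>, and the mean of \<open>\<partial>\<^sub>\<theta> Q\<close> vanishes.
\<close>

lemma pair_cmean:
  fixes g h :: "complex \<Rightarrow> complex"
  assumes g: "g holomorphic_on ball 0 1" and h: "h holomorphic_on ball 0 1"
    and pos: "\<And>z. norm z < 1 \<Longrightarrow> g z \<noteq> 0 \<or> h z \<noteq> 0" and q: "0 < q"
  obtains K where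
    "\<And>r. 0 < r \<Longrightarrow> r < 1 \<Longrightarrow>
       (cmean (\<lambda>z. ((norm (g z))\<^sup>2 + (norm (h z))\<^sup>2) powr q) has_real_derivative K r / r) (at r)"
    "mono_on {0..<1} K" "\<And>r. 0 \<le> r \<Longrightarrow> r < 1 \<Longrightarrow> 0 \<le> K r"
proof -
  define s where "s z = (norm (g z))\<^sup>2 + (norm (h z))\<^sup>2" for z
  define g' where "g' = deriv g" define h' where "h' = deriv h"
  define k where "k z = z * g' z" for z define l where "l z = z * h' z" for z
  define k' where "k' z = g' z + z * deriv g' z" for z define l' where "l' z = h' z + z * deriv h' z" for z
  have dg: "(g has_field_derivative g' z) (at z)" and dh: "(h has_field_derivative h' z) (at z)"
    and dk: "(k has_field_derivative k' z) (at z)" and dl: "(l has_field_derivative l' z) (at z)"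
    if "norm z < 1" for z
  proof -
    have o: "open (ball 0 1 :: complex set)" and z: "z \<in> ball 0 1" using that by auto
    show "(g has_field_derivative g' z) (at z)" "(h has_field_derivative h' z) (at z)"
      unfolding g'_def h'_def by (intro holomorphic_derivI[OF _ o z] g h)+
    have "(g' has_field_derivative deriv g' z) (at z)" "(h' has_field_derivative deriv h' z) (at z)"
      unfolding g'_def h'_def by (intro holomorphic_derivI[OF _ o z] holomorphic_deriv g h o)+
    then show "(k has_field_derivative k' z) (at z)" "(l has_field_derivative l' z) (at z)"
      unfolding k_def l_def k'_def l'_def by (auto intro!: derivative_eq_intros)
  qed
  have hol: "g' holomorphic_on ball 0 1" "h' holomorphic_on ball 0 1"
    unfolding g'_def h'_def by (intro holomorphic_deriv g h open_ball)+
  have hol2: "deriv g' holomorphic_on ball 0 1" "deriv h' holomorphic_on ball 0 1"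
    by (intro holomorphic_deriv hol open_ball)+
  note hc [continuous_intros] = hol[THEN holomorphic_on_imp_continuous_on] hol2[THEN holomorphic_on_imp_continuous_on]
    g[THEN holomorphic_on_imp_continuous_on] h[THEN holomorphic_on_imp_continuous_on]
  have spos: "0 < s z" if "norm z < 1" for z
    using pos[OF that] unfolding s_def by (metis add_nonneg_pos add_pos_nonneg zero_le_power2 zero_less_norm_iff zero_less_power)
  have sc [continuous_intros]: "continuous_on (ball 0 1) s" unfolding s_def by (intro continuous_intros)
  have powc [continuous_intros]: "continuous_on (ball 0 1) (\<lambda>z. s z powr b)" for b
    using spos by (intro continuous_intros) force
  define E where "E z = cnj (g z) * g' z + cnj (h z) * h' z" for z
  define F where "F z = cnj (g z) * k z + cnj (h z) * l z" for z
  have EF: "E z * z = F z" for z by (simp add: E_def F_def k_def l_def algebra_simps)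
  have Ec [continuous_intros]: "continuous_on (ball 0 1) E" unfolding E_def by (intro continuous_intros)
  have kc [continuous_intros]: "continuous_on (ball 0 1) k" "continuous_on (ball 0 1) l" "continuous_on (ball 0 1) k'" "continuous_on (ball 0 1) l'"
    unfolding k_def l_def k'_def l'_def by (intro continuous_intros)+
  have Fc [continuous_intros]: "continuous_on (ball 0 1) F" unfolding F_def by (intro continuous_intros)
  have gs: "has_grad s (2 * E z) z" if "norm z < 1" for z
    unfolding s_def by (rule has_grad_cong_simp, rule has_grad_add, (rule has_grad_norm_sq dg dh that)+)
      (simp add: E_def algebra_simps)
  define eu where "eu z = of_real (q * s z powr (q - 1)) * (2 * E z)" for z
  have gu: "has_grad (\<lambda>z. s z powr q) (eu z) z" if "norm z < 1" for z
    unfolding eu_def by (rule has_grad_powr gs spos that)+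
  define w where "w z = 2 * q * s z powr (q - 1)" for z
  define ew where "ew z = of_real (2 * q) * (of_real ((q - 1) * s z powr (q - 1 - 1)) * (2 * E z))" for z
  have gw: "has_grad w (ew z) z" if "norm z < 1" for z
    unfolding w_def ew_def by (rule has_grad_cmult has_grad_powr gs spos that)+
  define P where "P z = w z * Re (F z)" for z
  define Q where "Q z = w z * Im (F z)" for z
  define X where "X z = (cnj (k z) * g' z + cnj (g z) * k' z) + (cnj (l z) * h' z + cnj (h z) * l' z)" for z
  define Y where "Y z = \<i> * (cnj (k z) * g' z - cnj (g z) * k' z) + \<i> * (cnj (l z) * h' z - cnj (h z) * l' z)" for z
  define eP where "eP z = of_real (w z) * X z + of_real (Re (F z)) * ew z" for z
  define eQ where "eQ z = of_real (w z) * Y z + of_real (Im (F z)) * ew z" for z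
  have gP: "has_grad P (eP z) z" if "norm z < 1" for z
    unfolding P_def eP_def
  proof (rule has_grad_mult[OF gw[OF that]])
    show "has_grad (\<lambda>z. Re (F z)) (X z) z"
      unfolding F_def X_def plus_complex.sel by (intro has_grad_add has_grad_Re_cnj_mult dg dh dk dl that)
  qed
  have gQ: "has_grad Q (eQ z) z" if "norm z < 1" for z
    unfolding Q_def eQ_def
  proof (rule has_grad_mult[OF gw[OF that]])
    show "has_grad (\<lambda>z. Im (F z)) (Y z) z"
      unfolding F_def Y_def plus_complex.sel by (intro has_grad_add has_grad_Im_cnj_mult dg dh dk dl that)
  qed
  have wc [continuous_intros]: "continuous_on (ball 0 1) w" "continuous_on (ball 0 1) ew" "continuous_on (ball 0 1) X" "continuous_on (ball 0 1) Y"
    unfolding w_def ew_def X_def Y_def by (intro continuous_intros)+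
  have ePc [continuous_intros]: "continuous_on (ball 0 1) eP" and eQc [continuous_intros]: "continuous_on (ball 0 1) eQ"
    and euc: "continuous_on (ball 0 1) eu" and Pc: "continuous_on (ball 0 1) P"
    unfolding eP_def eQ_def eu_def P_def by (intro continuous_intros)+
  have sub: "{z. 0 < norm z \<and> norm z < 1} \<subseteq> (ball 0 1 :: complex set)" by auto
  \<comment> \<open>The difference is \<open>r \<partial>\<^sub>r P - \<partial>\<^sub>\<theta> Q\<close>, the Laplacian times \<open>r\<^sup>2\<close>.\<close>
  have lap: "0 \<le> Re (eP z * z) - Re (eQ z * (\<i> * z))" if "norm z < 1" for z
  proof -
    define N where "N = (norm (k z))\<^sup>2 + (norm (l z))\<^sup>2"
    define c where "c = (cnj (g z) * k' z + cnj (h z) * l' z) * z"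
    have ew: "Re (ew z * z) = 4 * q * (q - 1) * s z powr (q - 2) * Re (F z)"
      "Re (ew z * (\<i> * z)) = - 4 * q * (q - 1) * s z powr (q - 2) * Im (F z)"
      unfolding EF[symmetric] ew_def by (simp_all add: algebra_simps)
    have "X z * z = of_real N + c" "Y z * (\<i> * z) = c - of_real N"
      unfolding of_real_add complex_norm_square N_def c_def by (simp_all add: X_def Y_def k_def l_def algebra_simps)
    then have XY: "Re (X z * z) = N + Re c" "Re (Y z * (\<i> * z)) = Re c - N" by simp_all
    have eq: "Re (eP z * z) = w z * Re (X z * z) + Re (F z) * Re (ew z * z)"
      "Re (eQ z * (\<i> * z)) = w z * Re (Y z * (\<i> * z)) + Im (F z) * Re (ew z * (\<i> * z))"
      unfolding eP_def eQ_def distrib_right mult.assoc by simp_all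
    have "s z powr (q - 1) = s z powr (q - 2) * s z"
      using spos[OF that] powr_add[of "s z" "q - 2" 1] by (simp add: algebra_simps)
    then have "w z = 2 * q * s z powr (q - 2) * s z" by (simp add: w_def)
    then have "Re (eP z * z) - Re (eQ z * (\<i> * z)) = 4 * q * s z powr (q - 2) *
      ((q - 1) * ((Re (F z))\<^sup>2 + (Im (F z))\<^sup>2) + s z * N)"
      unfolding eq ew XY by (simp add: algebra_simps power2_eq_square)
    also have "\<dots> = 4 * q * s z powr (q - 2) *
      ((q - 1) * (norm (F z))\<^sup>2 + s z * N)"
      by (simp add: cmod_power2)
    also have "\<dots> \<ge> 0"
      unfolding F_def N_def using q by (intro mult_nonneg_nonneg pair_laplacian_nonneg) (auto simp: s_def)
    finally show ?thesis .
  qed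
  have Kd: "(cmean P has_real_derivative cmean (\<lambda>z. Re (eP z * z)) r / r) (at r)" if "0 < r" "r < 1" for r
    by (rule has_derivative_cmean[of r 0 1]) (use that gP continuous_on_subset[OF ePc sub] in auto)
  have Knn: "0 \<le> cmean (\<lambda>z. Re (eP z * z)) r" if "0 < r" "r < 1" for r
  proof -
    have "cmean (\<lambda>z. 0) r \<le> cmean (\<lambda>z. Re (eP z * z) - Re (eQ z * (\<i> * z))) r"
      using that by (intro cmean_mono lap continuous_intros) auto
    also have "\<dots> = cmean (\<lambda>z. Re (eP z * z)) r - cmean (\<lambda>z. Re (eQ z * (\<i> * z))) r"
      using that by (intro cmean_diff continuous_intros) auto
    also have "cmean (\<lambda>z. Re (eQ z * (\<i> * z))) r = 0"
      by (rule cmean_angular) (use that gQ in auto)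
    finally show ?thesis by simp
  qed
  have Kmono: "cmean P a \<le> cmean P b" if "0 \<le> a" "a \<le> b" "b < 1" for a b
  proof (rule DERIV_nonneg_imp_increasing_open[OF that(2)])
    show "\<exists>y. (cmean P has_real_derivative y) (at x) \<and> 0 \<le> y" if "a < x" "x < b" for x
      using Kd[of x] Knn[of x] that \<open>0 \<le> a\<close> \<open>b < 1\<close>
      by (intro exI[of _ "cmean (\<lambda>z. Re (eP z * z)) x / x"]) auto
    show "continuous_on {a..b} (cmean P)"
      using continuous_on_cmean[OF Pc] by (rule continuous_on_subset) (use that in auto)
  qed
  have "cmean P 0 = 0" by (simp add: P_def F_def k_def l_def)
  show thesis
  proof
    show "mono_on {0..<1} (cmean P)" using Kmono by (auto simp: mono_on_def)
    show "0 \<le> cmean P r" if "0 \<le> r" "r < 1" for r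
      using Kmono[of 0 r] that \<open>cmean P 0 = 0\<close> by simp
    fix r :: real assume r: "0 < r" "r < 1"
    have "(cmean (\<lambda>z. s z powr q) has_real_derivative cmean (\<lambda>z. Re (eu z * z)) r / r) (at r)"
      by (rule has_derivative_cmean[of r 0 1]) (use r gu continuous_on_subset[OF euc sub] in auto)
    moreover have "Re (eu z * z) = P z" for z
      unfolding P_def w_def eu_def EF[symmetric] by (simp add: algebra_simps)
    ultimately show "(cmean (\<lambda>z. ((norm (g z))\<^sup>2 + (norm (h z))\<^sup>2) powr q) has_real_derivative cmean P r / r) (at r)"
      by (simp add: s_def)
  qed
qed

section \<open>The flow of disc automorphisms\<close>

lemma has_grad_Re [simp]: "has_grad Re 1 z"
  by (simp add: has_grad_def has_derivative_Re)

lemma has_grad_Im [simp]: "has_grad Im (- \<i>) z"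
  by (simp add: has_grad_def has_derivative_Im)

lemma wint_cmult: "wint \<alpha> (\<lambda>r. c * M r) \<rho> = c * wint \<alpha> M \<rho>"
  by (simp add: wint_def mult.assoc) (simp add: algebra_simps)

text \<open>
  The generator of the flow: for \<open>n = Re (e (1 - z\<^sup>2)) - 2 \<alpha> Re z U\<close> and \<open>b(r)\<close> the mean of \<open>Re z U\<close>, the function
  \<open>mean(n) r (1 - r\<^sup>2)\<^sup>\<alpha>\<^sup>-\<^sup>2\<close> is the derivative of \<open>b(r) (1 - r\<^sup>2)\<^sup>\<alpha>\<^sup>-\<^sup>1\<close>, so that only a boundary term at \<open>\<rho>\<close>
  survives. Its exponent \<open>\<alpha>\<close>, one better than in the summands of \<open>wint\<close>, comes from a cancellation
  between the two summands.
\<close>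

lemma wint_divergence:
  assumes \<rho>: "0 < \<rho>" "\<rho> < 1" and g: "\<And>z. norm z < 1 \<Longrightarrow> has_grad U (e z) z"
    and ec: "continuous_on (ball 0 1) e"
  shows "wint \<alpha> (cmean (\<lambda>z. Re (e z * (1 - z\<^sup>2)) - 2 * \<alpha> * (Re z * U z))) \<rho>
       = (1 - \<rho>\<^sup>2) powr \<alpha> * cmean (\<lambda>z. Re z * U z + Re z * Re (e z * z)) \<rho> / \<rho>\<^sup>2"
proof -
  let ?n = "\<lambda>z. Re (e z * (1 - z\<^sup>2)) - 2 * \<alpha> * (Re z * U z)"
  let ?b = "\<lambda>z. Re z * U z"
  let ?b' = "\<lambda>z. Re z * U z + Re z * Re (e z * z)"
  let ?eb = "\<lambda>z. of_real (Re z) * e z + of_real (U z) * 1"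
  let ?ec = "\<lambda>z. of_real (Im z) * e z + of_real (U z) * (- \<i>)"
  have Uc: "continuous_on (ball 0 1) U" using g by (intro has_grad_continuous) auto
  note [continuous_intros] = ec Uc
  have gb: "has_grad ?b (?eb z) z" if "norm z < 1" for z by (intro has_grad_mult g that has_grad_Re)
  have gc: "has_grad (\<lambda>z. Im z * U z) (?ec z) z" if "norm z < 1" for z by (intro has_grad_mult g that has_grad_Im)
  have Bd: "(cmean ?b has_real_derivative cmean ?b' r / r) (at r)" if "0 < r" "r < 1" for r
  proof -
    have "(cmean ?b has_real_derivative cmean (\<lambda>z. Re (?eb z * z)) r / r) (at r)"
      by (rule has_derivative_cmean[of r 0 1])
         (use that gb in \<open>auto intro!: continuous_on_subset[of "ball 0 1"] continuous_intros\<close>)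
    moreover have "Re (?eb z * z) = ?b' z" for z by (simp add: algebra_simps)
    ultimately show ?thesis by simp
  qed
  have key: "r\<^sup>2 * cmean ?n r = (1 - r\<^sup>2) * cmean ?b' r - 2 * (\<alpha> - 1) * r\<^sup>2 * cmean ?b r" if r: "0 < r" "r < 1" for r
  proof -
    \<comment> \<open>On the circle, \<open>r\<^sup>2 (1 - z\<^sup>2) = z ((1 - r\<^sup>2) Re z - \<i> (1 + r\<^sup>2) Im z)\<close> splits the field into a radial and an angular part.\<close>
    have pt: "r\<^sup>2 * ?n z = ((1 - r\<^sup>2) * ?b' z - 2 * (\<alpha> - 1) * r\<^sup>2 * ?b z) - (1 + r\<^sup>2) * Re (?ec z * (\<i> * z))"
      if "norm z = r" for z
    proof -
      have r2: "r\<^sup>2 = (Re z)\<^sup>2 + (Im z)\<^sup>2" using that cmod_power2 by auto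
      show ?thesis unfolding r2 by (simp add: power2_eq_square algebra_simps)
    qed
    have "r\<^sup>2 * cmean ?n r = cmean (\<lambda>z. ((1 - r\<^sup>2) * ?b' z - 2 * (\<alpha> - 1) * r\<^sup>2 * ?b z) - (1 + r\<^sup>2) * Re (?ec z * (\<i> * z))) r"
      unfolding cmean_cmult[symmetric] using r by (intro cmean_cong pt) auto
    also have "\<dots> = cmean (\<lambda>z. (1 - r\<^sup>2) * ?b' z - 2 * (\<alpha> - 1) * r\<^sup>2 * ?b z) r - cmean (\<lambda>z. (1 + r\<^sup>2) * Re (?ec z * (\<i> * z))) r"
      using r by (intro cmean_diff continuous_intros) auto
    also have "cmean (\<lambda>z. (1 - r\<^sup>2) * ?b' z - 2 * (\<alpha> - 1) * r\<^sup>2 * ?b z) r = cmean (\<lambda>z. (1 - r\<^sup>2) * ?b' z) r - cmean (\<lambda>z. 2 * (\<alpha> - 1) * r\<^sup>2 * ?b z) r"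
      using r by (intro cmean_diff continuous_intros) auto
    also have "cmean (\<lambda>z. Re (?ec z * (\<i> * z))) r = 0"
      by (rule cmean_angular) (use r gc in auto)
    then have "cmean (\<lambda>z. (1 + r\<^sup>2) * Re (?ec z * (\<i> * z))) r = 0"
      unfolding cmean_cmult by simp
    finally show ?thesis by (simp only: cmean_cmult diff_zero)
  qed
  have "((\<lambda>r. cmean ?n r * (r * (1 - r\<^sup>2) powr (\<alpha> - 2))) has_integral
      (cmean ?b \<rho> * (1 - \<rho>\<^sup>2) powr (\<alpha> - 1) - cmean ?b 0 * (1 - 0\<^sup>2) powr (\<alpha> - 1))) {0..\<rho>}"
  proof (rule fundamental_theorem_of_calculus_interior)
    show "continuous_on {0..\<rho>} (\<lambda>r. cmean ?b r * (1 - r\<^sup>2) powr (\<alpha> - 1))"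
      by (intro continuous_intros continuous_on_weight \<rho> continuous_on_subset[OF continuous_on_cmean[of ?b]])
         (use \<rho> in auto)
    fix r assume "r \<in> {0<..<\<rho>}"
    then have r: "0 < r" "r < 1" using \<rho> by auto
    have pos: "0 < 1 - r\<^sup>2" using one_minus_sq_pos[of r r] r by simp
    have W: "((\<lambda>r. (1 - r\<^sup>2) powr (\<alpha> - 1)) has_real_derivative - (2 * (\<alpha>-1) * (r * (1 - r\<^sup>2) powr (\<alpha>-2)))) (at r)"
      using has_field_derivative_weight[of r "\<alpha> - 1"] r by simp
    have "(1 - r\<^sup>2) powr (\<alpha> - 1) = (1 - r\<^sup>2) powr (\<alpha> - 2) * (1 - r\<^sup>2)"
      using pos powr_add[of "1 - r\<^sup>2" "\<alpha> - 2" 1] by (simp add: algebra_simps)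
    moreover have "cmean ?n r * r = ((1 - r\<^sup>2) * cmean ?b' r - 2 * (\<alpha> - 1) * r\<^sup>2 * cmean ?b r) / r"
      unfolding key[OF r, symmetric] using r by (simp add: power2_eq_square)
    moreover have "b' / r * P1 + - (2 * (\<alpha>-1) * (r * P2)) * b = n * (r * P2)"
      if "P1 = P2 * (1 - r\<^sup>2)" "n * r = ((1 - r\<^sup>2) * b' - 2 * (\<alpha> - 1) * r\<^sup>2 * b) / r" for P1 P2 n b b' :: real
    proof -
      have "n * (r * P2) = ((1 - r\<^sup>2) * b' - 2 * (\<alpha> - 1) * r\<^sup>2 * b) / r * P2"
        unfolding that(2)[symmetric] by simp
      then show ?thesis unfolding that(1) using r by (simp add: field_simps power2_eq_square)
    qed
    ultimately have "cmean ?b' r / r * (1 - r\<^sup>2) powr (\<alpha> - 1) + - (2 * (\<alpha>-1) * (r * (1 - r\<^sup>2) powr (\<alpha>-2))) * cmean ?b r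
       = cmean ?n r * (r * (1 - r\<^sup>2) powr (\<alpha> - 2))"
      by blast
    with DERIV_mult[OF Bd[OF r] W]
    show "((\<lambda>r. cmean ?b r * (1 - r\<^sup>2) powr (\<alpha> - 1)) has_vector_derivative cmean ?n r * (r * (1 - r\<^sup>2) powr (\<alpha> - 2))) (at r)"
      unfolding has_real_derivative_iff_has_vector_derivative[symmetric] by simp
  qed (use \<rho> in auto)
  then have I: "integral {0..\<rho>} (\<lambda>r. cmean ?n r * (r * (1 - r\<^sup>2) powr (\<alpha> - 2))) = cmean ?b \<rho> * (1 - \<rho>\<^sup>2) powr (\<alpha> - 1)"
    by (simp add: integral_unique)
  have pos: "0 < 1 - \<rho>\<^sup>2" using one_minus_sq_pos[of \<rho> \<rho>] \<rho> by simp
  have pw: "(1 - \<rho>\<^sup>2) powr \<alpha> = (1 - \<rho>\<^sup>2) powr (\<alpha> - 1) * (1 - \<rho>\<^sup>2)"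
    using pos powr_add[of "1 - \<rho>\<^sup>2" "\<alpha> - 1" 1] by (simp add: algebra_simps)
  have "cmean ?n \<rho> = ((1 - \<rho>\<^sup>2) * cmean ?b' \<rho> - 2 * (\<alpha> - 1) * \<rho>\<^sup>2 * cmean ?b \<rho>) / \<rho>\<^sup>2"
    unfolding key[OF \<rho>, symmetric] using \<rho> by simp
  then have n: "cmean ?n \<rho> = (1 - \<rho>\<^sup>2) * cmean ?b' \<rho> / \<rho>\<^sup>2 - 2 * (\<alpha> - 1) * cmean ?b \<rho>"
    using \<rho> by (simp add: diff_divide_distrib)
  show ?thesis
    unfolding wint_def I n pw by (simp add: algebra_simps)
qed

text \<open>
  The automorphisms of the disc that fix 1 and \<open>-1\<close>, and the modulus of their derivative.
\<close>

definition mob :: "real \<Rightarrow> complex \<Rightarrow> complex" where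
  "mob t z = (z + of_real t) / (1 + of_real t * z)"

definition jac :: "real \<Rightarrow> complex \<Rightarrow> real" where
  "jac t z = (1 - t\<^sup>2) / (norm (1 + of_real t * z))\<^sup>2"

lemma mob_denom_ge:
  fixes z :: complex
  assumes "0 \<le> t" "t \<le> T" "norm z < 1"
  shows "1 - T \<le> norm (1 + of_real t * z)"
proof -
  have "norm (of_real t * z) \<le> T * 1"
    using assms unfolding norm_mult by (intro mult_mono) auto
  moreover have "1 - norm (of_real t * z) \<le> norm (1 + of_real t * z)"
    using norm_triangle_ineq2[of 1 "- (of_real t * z)"] by simp
  ultimately show ?thesis by simp
qed

lemma mob_denom_nz:
  fixes z :: complex
  assumes "0 \<le> t" "t < 1" "norm z < 1"
  shows "1 + of_real t * z \<noteq> 0"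
  using mob_denom_ge[of t t z] assms by auto

lemma one_minus_norm_mob:
  assumes "0 \<le> t" "t < 1" "norm z < 1"
  shows "1 - (norm (mob t z))\<^sup>2 = jac t z * (1 - (norm z)\<^sup>2)"
proof -
  have "(norm (1 + of_real t * z))\<^sup>2 - (norm (z + of_real t))\<^sup>2 = (1 - t\<^sup>2) * (1 - (norm z)\<^sup>2)"
    unfolding cmod_power2 by (simp add: power2_eq_square algebra_simps)
  moreover have "norm (1 + of_real t * z) \<noteq> 0" using mob_denom_nz[OF assms] by simp
  ultimately show ?thesis
    by (simp add: mob_def jac_def norm_divide power_divide field_simps)
qed

lemma jac_pos: "0 \<le> t \<Longrightarrow> t < 1 \<Longrightarrow> norm z < 1 \<Longrightarrow> 0 < jac t z"
  using mob_denom_nz[of t z] one_minus_sq_pos[of t t] by (simp add: jac_def)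

lemma norm_mob_less_1:
  assumes "0 \<le> t" "t < 1" "norm z < 1"
  shows "norm (mob t z) < 1"
proof -
  have "0 < 1 - (norm z)\<^sup>2" using one_minus_sq_pos[of "norm z" "norm z"] assms by simp
  then have "0 < 1 - (norm (mob t z))\<^sup>2"
    unfolding one_minus_norm_mob[OF assms] using jac_pos[OF assms] by simp
  then show ?thesis by (simp add: power_less_one_iff abs_square_less_1)
qed

lemma jac_le:
  assumes "0 \<le> t" "t \<le> T" "T < 1" "norm z < 1"
  shows "jac t z \<le> 1 / (1 - T)\<^sup>2"
  unfolding jac_def using mob_denom_ge[of t T z] mob_denom_nz[of t z] assms
  by (intro frac_le power_mono) auto

lemma mob_holomorphic: "0 \<le> t \<Longrightarrow> t < 1 \<Longrightarrow> mob t holomorphic_on ball 0 1"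
  unfolding mob_def using mob_denom_nz[of t] by (intro holomorphic_intros) auto

text \<open>
  The weighted pullback \<open>(v \<circ> \<phi>\<^sub>t) |\<phi>\<^sub>t'|\<^sup>\<alpha>\<close>, and its gradient in the sense of \<open>has_grad\<close>, where \<open>e\<close> is the gradient
  of \<open>v\<close>.
\<close>

definition pull :: "real \<Rightarrow> (complex \<Rightarrow> real) \<Rightarrow> real \<Rightarrow> complex \<Rightarrow> real" where
  "pull \<alpha> v t z = v (mob t z) * jac t z powr \<alpha>"

definition pull_grad ::
  "real \<Rightarrow> (complex \<Rightarrow> real) \<Rightarrow> (complex \<Rightarrow> complex) \<Rightarrow> real \<Rightarrow> complex \<Rightarrow> complex" where
  "pull_grad \<alpha> v e t z = of_real (jac t z powr \<alpha>) *
     (e (mob t z) * (of_real (1 - t\<^sup>2) / (1 + of_real t * z)\<^sup>2)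
      - of_real (2 * \<alpha> * t * v (mob t z)) / (1 + of_real t * z))"

lemma has_grad_comp:
  assumes "has_grad v e (g z)" "(g has_field_derivative d) (at z)"
  shows "has_grad (\<lambda>z. v (g z)) (e * d) z"
  using has_derivative_compose[OF assms(2)[unfolded has_field_derivative_def] assms(1)[unfolded has_grad_def]]
  by (simp add: has_grad_def mult.assoc)

lemma has_grad_jac:
  assumes t: "0 \<le> t" "t < 1" "norm z < 1"
  shows "has_grad (jac t) (- (of_real (2 * t * jac t z) / (1 + of_real t * z))) z"
proof -
  let ?d = "1 + of_real t * z"
  have nz: "?d \<noteq> 0" by (rule mob_denom_nz[OF t])
  have "has_grad (\<lambda>z. (norm (1 + of_real t * z))\<^sup>2) (2 * cnj ?d * of_real t) z"
    by (rule has_grad_norm_sq) (auto intro!: derivative_eq_intros)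
  from has_grad_powr[OF this, of "-1"] nz
  have "has_grad (\<lambda>z. (norm (1 + of_real t * z))\<^sup>2 powr -1) (of_real (- ((norm ?d)\<^sup>2 powr -2)) * (2 * cnj ?d * of_real t)) z"
    by simp
  from has_grad_cmult[OF this, of "1 - t\<^sup>2"]
  have *: "has_grad (\<lambda>z. (1 - t\<^sup>2) * (norm (1 + of_real t * z))\<^sup>2 powr -1)
     (of_real (1 - t\<^sup>2) * (of_real (- ((norm ?d)\<^sup>2 powr -2)) * (2 * cnj ?d * of_real t))) z" .
  have eq: "(\<lambda>z. (1 - t\<^sup>2) * (norm (1 + of_real t * z))\<^sup>2 powr -1) = jac t"
    by (auto simp: jac_def fun_eq_iff powr_minus powr_one divide_inverse)
  have p2: "((norm ?d)\<^sup>2 powr -2) = 1 / ((norm ?d)\<^sup>2)\<^sup>2"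
    using nz by (simp add: powr_minus powr_numeral divide_inverse)
  have cn: "cnj ?d = of_real ((norm ?d)\<^sup>2) / ?d"
    unfolding complex_norm_square using nz by simp
  have N: "of_real ((norm ?d)\<^sup>2) \<noteq> (0::complex)" using nz by simp
  have e: "of_real (1 - t\<^sup>2) * (of_real (- ((norm ?d)\<^sup>2 powr -2)) * (2 * cnj ?d * of_real t))
     = - (of_real (2 * t * jac t z) / ?d)"
    unfolding p2 cn jac_def of_real_mult of_real_divide of_real_minus of_real_power[of "(norm ?d)\<^sup>2" 2]
    using N nz by (simp only: power2_eq_square[of "of_real ((norm ?d)\<^sup>2)"]) (simp add: divide_simps)
  show ?thesis using * unfolding eq e .
qed

lemma has_grad_pull:
  assumes t: "0 \<le> t" "t < 1" "norm z < 1" and g: "\<And>z. norm z < 1 \<Longrightarrow> has_grad v (e z) z"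
  shows "has_grad (pull \<alpha> v t) (pull_grad \<alpha> v e t z) z"
proof -
  let ?d = "1 + of_real t * z"
  have nz: "?d \<noteq> 0" by (rule mob_denom_nz[OF t])
  have J: "0 < jac t z" by (rule jac_pos[OF t])
  have 1: "(mob t has_field_derivative of_real (1 - t\<^sup>2) / ?d\<^sup>2) (at z)"
    unfolding mob_def[abs_def]
    by (rule derivative_eq_intros refl nz)+ (simp add: field_simps power2_eq_square)
  have 2: "jac t z powr \<alpha> = jac t z powr (\<alpha> - 1) * jac t z"
    using J powr_add[of "jac t z" "\<alpha> - 1" 1] by (simp add: algebra_simps)
  show ?thesis
    unfolding pull_def[abs_def]
  proof (rule has_grad_cong_simp[OF has_grad_mult[OF has_grad_comp[OF g[OF norm_mob_less_1[OF t]] 1]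
        has_grad_powr[OF has_grad_jac[OF t] J, of \<alpha>]]])
    show "of_real (v (mob t z)) * (of_real (\<alpha> * jac t z powr (\<alpha> - 1)) * - (of_real (2 * t * jac t z) / ?d)) +
       of_real (jac t z powr \<alpha>) * (e (mob t z) * (of_real (1 - t\<^sup>2) / ?d\<^sup>2)) = pull_grad \<alpha> v e t z"
      unfolding pull_grad_def 2 by (simp add: algebra_simps)
  qed
qed

text \<open>
  The transport equation: \<open>(1 - t\<^sup>2) \<partial>\<^sub>t U\<close> is the expression integrated in \<open>wint_divergence\<close>. It expresses that
  \<open>(1 - z\<^sup>2) \<partial>\<^sub>z\<close> generates the automorphisms \<open>\<phi>\<^sub>t\<close>, up to the time change \<open>t = tanh s\<close>.
\<close>

lemma has_derivative_pull_param:
  assumes t: "0 \<le> t" "t < 1" "norm z < 1" and g: "\<And>z. norm z < 1 \<Longrightarrow> has_grad v (e z) z"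
  shows "((\<lambda>t. pull \<alpha> v t z) has_real_derivative
     (Re (pull_grad \<alpha> v e t z * (1 - z\<^sup>2)) - 2 * \<alpha> * (Re z * pull \<alpha> v t z)) / (1 - t\<^sup>2)) (at t within X)"
proof -
  let ?d = "1 + of_real t * z"
  have nz: "?d \<noteq> 0" by (rule mob_denom_nz[OF t])
  have J: "0 < jac t z" by (rule jac_pos[OF t])
  have T: "0 < 1 - t\<^sup>2" using one_minus_sq_pos[of t t] t by simp
  have "((\<lambda>x. (z + x) / (1 + x * z)) has_field_derivative (1 - z\<^sup>2) / ?d\<^sup>2) (at (of_real t))"
    by (rule derivative_eq_intros refl nz)+ (simp add: field_simps power2_eq_square nz)
  from has_vector_derivative_real_field[OF this]
  have 1: "((\<lambda>t. mob t z) has_vector_derivative (1 - z\<^sup>2) / ?d\<^sup>2) (at t within X)"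
    by (simp add: mob_def)
  note A = has_grad_path[OF g[OF norm_mob_less_1[OF t]] 1]
  have N: "(norm (1 + of_real t * z))\<^sup>2 = 1 + 2 * t * Re z + t\<^sup>2 * (norm z)\<^sup>2" for t
    unfolding cmod_power2 by (simp add: power2_eq_square algebra_simps)
  have Np: "0 < 1 + 2 * t * Re z + t\<^sup>2 * (norm z)\<^sup>2" unfolding N[symmetric] using nz by simp
  have dR: "Re (z / ?d) = (Re z + t * (norm z)\<^sup>2) / (norm ?d)\<^sup>2"
    unfolding Re_divide' cmod_power2 by (simp add: power2_eq_square algebra_simps)
  have B0: "((\<lambda>t. jac t z) has_real_derivative
     ((- 2 * t) * (1 + 2 * t * Re z + t\<^sup>2 * (norm z)\<^sup>2) - (1 - t\<^sup>2) * (2 * Re z + 2 * t * (norm z)\<^sup>2))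
        / (1 + 2 * t * Re z + t\<^sup>2 * (norm z)\<^sup>2)\<^sup>2) (at t within X)"
    unfolding jac_def N using Np
    by (auto intro!: derivative_eq_intros simp: power2_eq_square)
  have "((- 2 * t) * (norm ?d)\<^sup>2 - (1 - t\<^sup>2) * (2 * Re z + 2 * t * (norm z)\<^sup>2)) / ((norm ?d)\<^sup>2)\<^sup>2
      = jac t z * (- (2 * t / (1 - t\<^sup>2)) - 2 * Re (z / ?d))"
    unfolding dR jac_def using T nz by (simp add: field_simps power2_eq_square[of "(norm ?d)\<^sup>2"])
  then have B1: "((\<lambda>t. jac t z) has_real_derivative jac t z * (- (2 * t / (1 - t\<^sup>2)) - 2 * Re (z / ?d))) (at t within X)"
    using B0 unfolding N by simp
  have 2: "jac t z powr \<alpha> = jac t z powr (\<alpha> - 1) * jac t z"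
    using J powr_add[of "jac t z" "\<alpha> - 1" 1] by (simp add: algebra_simps)
  have B: "((\<lambda>t. jac t z powr \<alpha>) has_real_derivative \<alpha> * jac t z powr \<alpha> * (- (2 * t / (1 - t\<^sup>2)) - 2 * Re (z / ?d))) (at t within X)"
    using DERIV_chain2[OF has_real_derivative_powr[OF J, of \<alpha>] B1] by (simp add: 2 mult.assoc)
  have Re_lin: "Re (2 * z - of_real a - of_real b * y) = 2 * Re z - a - b * Re y" for a b y
    by simp
  have "(- (2 * of_real t) * (1 - z\<^sup>2)) / ?d = 2 * z - of_real (2 * t) - of_real (2 * (1 - t\<^sup>2)) * (z / ?d)"
    using nz by (simp add: field_simps power2_eq_square)
  then have "Re ((- (2 * of_real t) * (1 - z\<^sup>2)) / ?d) = 2 * Re z - 2 * t - 2 * (1 - t\<^sup>2) * Re (z / ?d)"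
    by (simp only: Re_lin)
  then have C: "- (2 * t / (1 - t\<^sup>2)) - 2 * Re (z / ?d) = (Re ((- (2 * of_real t) * (1 - z\<^sup>2)) / ?d) - 2 * Re z) / (1 - t\<^sup>2)"
    using T by (simp add: field_simps)
  let ?a = "e (mob t z)" and ?v = "v (mob t z)" and ?j = "jac t z powr \<alpha>"
  have D: "Re (pull_grad \<alpha> v e t z * (1 - z\<^sup>2)) =
     ?j * ((1 - t\<^sup>2) * Re (?a * ((1 - z\<^sup>2) / ?d\<^sup>2)) + \<alpha> * ?v * Re ((- (2 * of_real t) * (1 - z\<^sup>2)) / ?d))"
  proof -
    have "pull_grad \<alpha> v e t z * (1 - z\<^sup>2) =
       of_real ?j * (of_real (1 - t\<^sup>2) * (?a * ((1 - z\<^sup>2) / ?d\<^sup>2)) + of_real (\<alpha> * ?v) * ((- (2 * of_real t) * (1 - z\<^sup>2)) / ?d))"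
      unfolding pull_grad_def by (simp add: algebra_simps diff_divide_distrib)
    moreover have "Re (of_real j * (of_real a * x + of_real b * y)) = j * (a * Re x + b * Re y)" for j a b x y
      by simp
    ultimately show ?thesis by (simp only: )
  qed
  show ?thesis
    unfolding pull_def
  proof (rule DERIV_cong[OF DERIV_mult[OF A B]])
    show "Re (?a * ((1 - z\<^sup>2) / ?d\<^sup>2)) * ?j + \<alpha> * ?j * (- (2 * t / (1 - t\<^sup>2)) - 2 * Re (z / ?d)) * ?v
       = (Re (pull_grad \<alpha> v e t z * (1 - z\<^sup>2)) - 2 * \<alpha> * (Re z * (?v * ?j))) / (1 - t\<^sup>2)"
      unfolding C D using T by (simp add: field_simps)
  qed
qed

lemma continuous_on_mob:
  assumes T: "T < 1"
  shows "continuous_on ({0..T} \<times> ball 0 1) (\<lambda>p. mob (fst p) (snd p))"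
    "continuous_on ({0..T} \<times> ball 0 1) (\<lambda>p. jac (fst p) (snd p))"
proof -
  have nz: "1 + of_real (fst p) * snd p \<noteq> 0" if "p \<in> {0..T} \<times> ball 0 1" for p :: "real \<times> complex"
    using mob_denom_nz[of "fst p" "snd p"] that T by auto
  show "continuous_on ({0..T} \<times> ball 0 1) (\<lambda>p. mob (fst p) (snd p))"
    "continuous_on ({0..T} \<times> ball 0 1) (\<lambda>p. jac (fst p) (snd p))"
    unfolding mob_def jac_def using nz by (auto intro!: continuous_intros)
qed

lemma continuous_on_pull:
  assumes T: "T < 1" and v: "continuous_on (ball 0 1) v" and e: "continuous_on (ball 0 1) e"
  shows "continuous_on ({0..T} \<times> ball 0 1) (\<lambda>p. pull \<alpha> v (fst p) (snd p))"
    "continuous_on ({0..T} \<times> ball 0 1) (\<lambda>p. pull_grad \<alpha> v e (fst p) (snd p))"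
proof -
  have nz: "1 + of_real (fst p) * snd p \<noteq> 0" and jp: "0 < jac (fst p) (snd p)" and m: "norm (mob (fst p) (snd p)) < 1"
    if "p \<in> {0..T} \<times> ball 0 1" for p :: "real \<times> complex"
    using mob_denom_nz[of "fst p" "snd p"] jac_pos[of "fst p" "snd p"] norm_mob_less_1[of "fst p" "snd p"] that T by auto
  have [continuous_intros]: "continuous_on ({0..T} \<times> ball 0 1) (\<lambda>p. v (mob (fst p) (snd p)))"
    "continuous_on ({0..T} \<times> ball 0 1) (\<lambda>p. e (mob (fst p) (snd p)))"
    by (rule continuous_on_compose2[OF v continuous_on_mob(1)[OF T]] continuous_on_compose2[OF e continuous_on_mob(1)[OF T]];
        use m in auto)+
  have [continuous_intros]: "continuous_on ({0..T} \<times> ball 0 1) (\<lambda>p. jac (fst p) (snd p) powr \<alpha>)"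
    by (intro continuous_intros continuous_on_mob T) (use jp in force)
  show "continuous_on ({0..T} \<times> ball 0 1) (\<lambda>p. pull \<alpha> v (fst p) (snd p))"
    unfolding pull_def by (intro continuous_intros)
  show "continuous_on ({0..T} \<times> ball 0 1) (\<lambda>p. pull_grad \<alpha> v e (fst p) (snd p))"
    unfolding pull_grad_def by (intro continuous_intros) (use nz in auto)
qed

text \<open>
  For \<open>v\<close> bounded with bounded gradient, the flow increases the functional of \<open>v\<close> at most by an
  error that vanishes as \<open>\<rho> \<rightarrow> 1\<close>. The lower bound 1/2 on \<open>\<rho>\<close> only keeps \<open>1 / \<rho>\<^sup>2\<close> bounded.
\<close>

lemma wint_pull_le:
  assumes \<alpha>: "0 < \<alpha>" and T: "0 \<le> T" "T < 1" and g: "\<And>z. norm z < 1 \<Longrightarrow> has_grad v (e z) z"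
    and ec: "continuous_on (ball 0 1) e"
    and B: "\<And>z. norm z < 1 \<Longrightarrow> \<bar>v z\<bar> \<le> B" "\<And>z. norm z < 1 \<Longrightarrow> norm (e z) \<le> B"
  obtains C where "\<And>\<rho>. 1 / 2 \<le> \<rho> \<Longrightarrow> \<rho> < 1 \<Longrightarrow>
     wint \<alpha> (cmean (pull \<alpha> v T)) \<rho> \<le> wint \<alpha> (cmean v) \<rho> + C * (1 - \<rho>\<^sup>2) powr \<alpha>"
proof -
  have B0: "0 \<le> B" using B(1)[of 0] by simp
  have vc: "continuous_on (ball 0 1) v" using g by (intro has_grad_continuous) auto
  define E where "E = (1 / (1 - T)\<^sup>2) powr \<alpha>"
  define C1 where "C1 = B * E"
  define C2 where "C2 = E * (B * (1 / (1 - T)\<^sup>2) + 2 * \<alpha> * B / (1 - T))"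
  let ?n = "\<lambda>t z. Re (pull_grad \<alpha> v e t z * (1 - z\<^sup>2)) - 2 * \<alpha> * (Re z * pull \<alpha> v t z)"
  have tc: "continuous_on (ball 0 1) (pull \<alpha> v t)" "continuous_on (ball 0 1) (pull_grad \<alpha> v e t)" if "t \<in> {0..T}" for t
    using that by (auto intro!: continuous_on_compose2[OF continuous_on_pull(1)[OF T(2) vc ec, of \<alpha>], of _ "\<lambda>z. (t, z)", simplified]
      continuous_on_compose2[OF continuous_on_pull(2)[OF T(2) vc ec, of \<alpha>], of _ "\<lambda>z. (t, z)", simplified] continuous_intros)
  have b1: "\<bar>pull \<alpha> v t z\<bar> \<le> C1" and b2: "norm (pull_grad \<alpha> v e t z) \<le> C2"
    if t: "t \<in> {0..T}" and z: "norm z < 1" for t z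
  proof -
    have t': "0 \<le> t" "t < 1" using t T by auto
    have j: "jac t z powr \<alpha> \<le> E"
      unfolding E_def using t T z \<alpha> jac_pos[OF t' z] by (intro powr_mono2 jac_le) auto
    have m: "norm (mob t z) < 1" by (rule norm_mob_less_1[OF t' z])
    show "\<bar>pull \<alpha> v t z\<bar> \<le> C1"
      unfolding pull_def C1_def abs_mult using j B0 by (intro mult_mono B m) auto
    have d: "1 - T \<le> norm (1 + of_real t * z)" using mob_denom_ge[of t T z] t z by simp
    have t2: "\<bar>1 - t\<^sup>2\<bar> \<le> 1" using one_minus_sq_pos[of t t] t' by simp
    have "norm (e (mob t z) * (of_real (1 - t\<^sup>2) / (1 + of_real t * z)\<^sup>2)
      - of_real (2 * \<alpha> * t * v (mob t z)) / (1 + of_real t * z)) \<le>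
      norm (e (mob t z)) * (\<bar>1 - t\<^sup>2\<bar> / (norm (1 + of_real t * z))\<^sup>2)
      + \<bar>2 * \<alpha> * t * v (mob t z)\<bar> / norm (1 + of_real t * z)"
      by (rule order_trans[OF norm_triangle_ineq4]) (simp only: norm_mult norm_divide norm_power norm_of_real order_refl)
    also have "\<dots> \<le> B * (1 / (1 - T)\<^sup>2) + 2 * \<alpha> * B / (1 - T)"
    proof (intro add_mono mult_mono frac_le power_mono B m t2 d)
      have "\<bar>t * v (mob t z)\<bar> \<le> 1 * B" unfolding abs_mult using t' by (intro mult_mono B m) auto
      then show "\<bar>2 * \<alpha> * t * v (mob t z)\<bar> \<le> 2 * \<alpha> * B"
        using \<alpha> by (simp add: abs_mult mult.assoc)
    qed (use T B0 \<alpha> in auto)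
    finally show "norm (pull_grad \<alpha> v e t z) \<le> C2"
      unfolding pull_grad_def C2_def norm_mult norm_of_real using j
      by (intro mult_mono) (auto simp: E_def)
  qed
  define D where "D = (C1 + C2) * 4 / (1 - T\<^sup>2)"
  have C0: "0 \<le> C1" "0 \<le> C2" using b1[of 0 0] b2[of 0 0] T by (auto intro: order_trans[OF abs_ge_zero] order_trans[OF norm_ge_zero])
  have T2: "0 < 1 - T\<^sup>2" using one_minus_sq_pos[of T T] T by simp
  show thesis
  proof
    fix \<rho> :: real assume \<rho>: "1 / 2 \<le> \<rho>" "\<rho> < 1"
    have \<rho>0: "0 < \<rho>" using \<rho> by simp
    let ?W = "\<lambda>t. wint \<alpha> (cmean (pull \<alpha> v t)) \<rho>"
    let ?W' = "\<lambda>t. wint \<alpha> (cmean (\<lambda>z. ?n t z / (1 - t\<^sup>2))) \<rho>"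
    have W: "(?W has_real_derivative ?W' t) (at t within {0..T})" if t: "t \<in> {0..T}" for t
    proof (rule has_derivative_wint_param)
      show "continuous_on ({0..T} \<times> ball 0 1) (\<lambda>(t, z). ?n t z / (1 - t\<^sup>2))"
        unfolding split_beta
        by (intro continuous_intros continuous_on_pull[OF T(2) vc ec])
           (use T one_minus_sq_pos[of _ T] in force)
      show "((\<lambda>t. pull \<alpha> v t z) has_real_derivative ?n t z / (1 - t\<^sup>2)) (at t within {0..T})"
        if "t \<in> {0..T}" "norm z < 1" for t z
        by (rule has_derivative_pull_param) (use that T g in auto)
    qed (use t tc \<rho> in auto)
    have W'b: "\<bar>?W' t\<bar> \<le> D * (1 - \<rho>\<^sup>2) powr \<alpha>" if t: "t \<in> {0..T}" for t
    proof -
      let ?G = "cmean (\<lambda>z. Re z * pull \<alpha> v t z + Re z * Re (pull_grad \<alpha> v e t z * z)) \<rho>"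
      have t2: "1 - T\<^sup>2 \<le> 1 - t\<^sup>2" using t by (simp add: power_mono)
      have G: "\<bar>?G\<bar> \<le> C1 + C2"
      proof (rule cmean_abs_le)
        show "continuous_on (ball 0 1) (\<lambda>z. Re z * pull \<alpha> v t z + Re z * Re (pull_grad \<alpha> v e t z * z))"
          by (intro continuous_intros tc t)
        fix z :: complex assume "norm z = \<bar>\<rho>\<bar>"
        then have z: "norm z < 1" using \<rho> by simp
        have r: "\<bar>Re z\<bar> \<le> 1" using abs_Re_le_cmod[of z] z by linarith
        have "\<bar>Re z * pull \<alpha> v t z + Re z * Re (pull_grad \<alpha> v e t z * z)\<bar>
          \<le> \<bar>Re z\<bar> * \<bar>pull \<alpha> v t z\<bar> + \<bar>Re z\<bar> * \<bar>Re (pull_grad \<alpha> v e t z * z)\<bar>"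
          unfolding abs_mult[symmetric] by (rule abs_triangle_ineq)
        also have "\<bar>Re (pull_grad \<alpha> v e t z * z)\<bar> \<le> norm (pull_grad \<alpha> v e t z) * norm z"
          unfolding norm_mult[symmetric] by (rule abs_Re_le_cmod)
        also have "\<dots> \<le> C2 * 1" using z C0 by (intro mult_mono b2 t) auto
        also have "\<bar>Re z\<bar> * \<bar>pull \<alpha> v t z\<bar> + \<bar>Re z\<bar> * (C2 * 1) \<le> 1 * C1 + 1 * (C2 * 1)"
          using r C0 z by (intro add_mono mult_mono b1 t) auto
        finally show "\<bar>Re z * pull \<alpha> v t z + Re z * Re (pull_grad \<alpha> v e t z * z)\<bar> \<le> C1 + C2"
          by (simp add: mult_left_mono)
      qed (use \<rho> in auto)
      have "?W' t = wint \<alpha> (cmean (?n t)) \<rho> / (1 - t\<^sup>2)"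
      proof -
        have "cmean (\<lambda>z. ?n t z / (1 - t\<^sup>2)) = (\<lambda>r. 1 / (1 - t\<^sup>2) * cmean (?n t) r)"
          unfolding cmean_cmult[symmetric] by (simp add: fun_eq_iff)
        then show ?thesis by (simp only: wint_cmult) simp
      qed
      also have "wint \<alpha> (cmean (?n t)) \<rho> = (1 - \<rho>\<^sup>2) powr \<alpha> * ?G / \<rho>\<^sup>2"
        by (rule wint_divergence[OF \<rho>0 \<rho>(2) has_grad_pull tc(2)[OF t]]) (use t T g in auto)
      finally have "\<bar>?W' t\<bar> = (1 - \<rho>\<^sup>2) powr \<alpha> * (\<bar>?G\<bar> * (1 / \<rho>\<^sup>2) / \<bar>1 - t\<^sup>2\<bar>)"
        by (simp add: abs_mult)
      also have "\<dots> \<le> (1 - \<rho>\<^sup>2) powr \<alpha> * ((C1 + C2) * 4 / (1 - T\<^sup>2))"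
      proof (intro mult_left_mono frac_le mult_mono G)
        have "(1/2)\<^sup>2 \<le> \<rho>\<^sup>2" using \<rho> by (intro power_mono) auto
        then show "1 / \<rho>\<^sup>2 \<le> 4" using \<rho>0 by (simp add: field_simps power2_eq_square)
      qed (use C0 T2 t2 in auto)
      finally show ?thesis by (simp add: D_def mult.commute)
    qed
    have "norm (?W T - ?W 0) \<le> (D * (1 - \<rho>\<^sup>2) powr \<alpha>) * norm (T - 0)"
      by (rule field_differentiable_bound[of "{0..T}" ?W ?W']) (use W W'b T in auto)
    also have "\<dots> \<le> (D * (1 - \<rho>\<^sup>2) powr \<alpha>) * 1"
      using T C0 T2 by (intro mult_left_mono) (auto simp: D_def)
    finally have "?W T \<le> ?W 0 + D * (1 - \<rho>\<^sup>2) powr \<alpha>" by simp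
    moreover have "pull \<alpha> v 0 = v" by (simp add: pull_def[abs_def] mob_def jac_def)
    ultimately show "?W T \<le> wint \<alpha> (cmean v) \<rho> + D * (1 - \<rho>\<^sup>2) powr \<alpha>" by simp
  qed
qed

section \<open>Regularisation and dilation\<close>

text \<open>
  With \<open>c = 1 - |w|\<^sup>2\<close> and \<open>1 - cnj w * z\<close> in place of \<open>z\<close>, this is the modulus of the holomorphic factor of the operator.
\<close>

lemma norm_weight_factor:
  fixes z :: complex
  assumes "0 < c" "z \<noteq> 0"
  shows "norm (of_real (c powr \<kappa>) / z powr of_real (2 * \<kappa>)) = (c / (norm z)\<^sup>2) powr \<kappa>"
proof -
  have "norm (z powr of_real (2 * \<kappa>)) = norm z powr (2 * \<kappa>)"
    using assms by (simp add: norm_powr_real_powr')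
  also have "\<dots> = ((norm z)\<^sup>2) powr \<kappa>"
    using assms by (simp add: powr_powr flip: powr_numeral)
  finally show ?thesis
    using assms by (simp add: norm_divide powr_divide)
qed

lemma sq_powr_half: "0 \<le> x \<Longrightarrow> (x\<^sup>2) powr (p / 2) = (x::real) powr p"
  by (cases "x = 0") (simp_all add: powr_powr flip: powr_numeral)

text \<open>
  The regularisation \<open>(|f|\<^sup>2 + \<delta>\<^sup>2)\<^sup>p\<^sup>/\<^sup>2\<close> of \<open>|f|\<^sup>p\<close>; for holomorphic \<open>f\<close> and \<open>\<delta> > 0\<close> it is smooth also at the zeros of \<open>f\<close>.
\<close>

definition reg_power :: "real \<Rightarrow> real \<Rightarrow> (complex \<Rightarrow> complex) \<Rightarrow> complex \<Rightarrow> real" where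
  "reg_power p \<delta> f z = ((norm (f z))\<^sup>2 + \<delta>\<^sup>2) powr (p / 2)"

lemma reg_power_mono: "0 < p \<Longrightarrow> 0 \<le> \<delta> \<Longrightarrow> \<delta> \<le> \<epsilon> \<Longrightarrow> norm (f z) \<le> norm (g z) \<Longrightarrow> reg_power p \<delta> f z \<le> reg_power p \<epsilon> g z"
  unfolding reg_power_def by (intro powr_mono2 add_mono power_mono) auto

lemma reg_power_bound:
  assumes "0 < p" "0 \<le> \<delta>" "\<delta> \<le> 1" "norm (f z) \<le> B"
  shows "\<bar>reg_power p \<delta> f z\<bar> \<le> (B\<^sup>2 + 1\<^sup>2) powr (p / 2)"
proof -
  have "((norm (f z))\<^sup>2 + \<delta>\<^sup>2) powr (p / 2) \<le> (B\<^sup>2 + 1\<^sup>2) powr (p / 2)"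
    using assms by (intro powr_mono2 add_mono power_mono) auto
  then show ?thesis by (simp add: reg_power_def)
qed

lemma reg_power_nonneg: "0 \<le> reg_power p \<delta> f z"
  by (simp add: reg_power_def)

lemma continuous_on_reg_power:
  assumes "0 < p" "continuous_on S f"
  shows "continuous_on S (reg_power p \<delta> f)"
  unfolding reg_power_def using assms
  by (intro continuous_on_powr' continuous_intros) auto

lemma reg_power_cmean:
  assumes p: "0 < p" and \<delta>: "0 < \<delta>" and f: "f holomorphic_on ball 0 1"
  obtains K where
    "\<And>r. 0 < r \<Longrightarrow> r < 1 \<Longrightarrow> (cmean (reg_power p \<delta> f) has_real_derivative K r / r) (at r)"
    "mono_on {0..<1} K" "\<And>r. 0 \<le> r \<Longrightarrow> r < 1 \<Longrightarrow> 0 \<le> K r"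
proof -
  have eq: "(\<lambda>z. ((norm (f z))\<^sup>2 + (norm (of_real \<delta> :: complex))\<^sup>2) powr (p / 2)) = reg_power p \<delta> f"
    by (simp add: reg_power_def fun_eq_iff)
  show thesis
    by (rule pair_cmean[OF f holomorphic_on_const _ half_gt_zero[OF p], of "of_real \<delta>", unfolded eq])
      (use \<delta> in simp, rule that)
qed

text \<open>
  The pullback of a regularised power is again a power of \<open>|g|\<^sup>2 + |h|\<^sup>2\<close>, with \<open>g = (f \<circ> \<phi>) H\<close>, \<open>h = \<delta> H\<close> and
  \<open>H\<close> a branch of \<open>(\<phi>')\<close> to the power \<open>\<alpha> / p\<close>. Hence its circle means increase, and so does the functional.
\<close>

lemma pull_reg_power_mono:
  assumes \<alpha>: "0 < \<alpha>" and p: "0 < p" and \<delta>: "0 < \<delta>" and T: "0 \<le> T" "T < 1"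
    and f: "f holomorphic_on ball 0 1" and \<rho>: "0 \<le> \<rho>" "\<rho> \<le> \<sigma>" "\<sigma> < 1"
  shows "wint \<alpha> (cmean (pull \<alpha> (reg_power p \<delta> f) T)) \<rho> \<le> wint \<alpha> (cmean (pull \<alpha> (reg_power p \<delta> f) T)) \<sigma>"
proof -
  define H where "H z = of_real ((1 - T\<^sup>2) powr (\<alpha> / p)) / (1 + of_real T * z) powr of_real (2 * (\<alpha> / p))" for z :: complex
  define g where "g z = f (mob T z) * H z" for z
  define h where "h z = of_real \<delta> * H z" for z
  have T2: "0 < 1 - T\<^sup>2" using one_minus_sq_pos[of T T] T by simp
  have Repos: "0 < Re (1 + of_real T * z)" if "norm z < 1" for z
  proof -
    have "\<bar>T * Re z\<bar> \<le> T * norm z" using T abs_Re_le_cmod[of z] by (simp add: abs_mult mult_left_mono)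
    also have "\<dots> \<le> T * 1" using T that by (intro mult_left_mono) auto
    finally show ?thesis using T by simp
  qed
  have nonp: "1 + of_real T * z \<notin> \<real>\<^sub>\<le>\<^sub>0" if "norm z < 1" for z :: complex
    using Repos[OF that] by (auto simp: complex_nonpos_Reals_iff)
  have Hhol: "H holomorphic_on ball 0 1"
    unfolding H_def using nonp mob_denom_nz[OF T] by (intro holomorphic_intros) auto
  have ghol: "g holomorphic_on ball 0 1"
    unfolding g_def using norm_mob_less_1[OF T]
    by (intro holomorphic_on_mult Hhol holomorphic_on_compose_gen[OF mob_holomorphic[OF T] f, unfolded o_def]) auto
  have hhol: "h holomorphic_on ball 0 1"
    unfolding h_def by (intro holomorphic_intros Hhol)
  have nH: "norm (H z) = jac T z powr (\<alpha> / p)" if "norm z < 1" for z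
    unfolding H_def jac_def by (rule norm_weight_factor) (use T2 mob_denom_nz[OF T that] in auto)
  have eq: "pull \<alpha> (reg_power p \<delta> f) T z = ((norm (g z))\<^sup>2 + (norm (h z))\<^sup>2) powr (p / 2)" if z: "norm z < 1" for z
  proof -
    have "(norm (g z))\<^sup>2 + (norm (h z))\<^sup>2 = ((norm (f (mob T z)))\<^sup>2 + \<delta>\<^sup>2) * (norm (H z))\<^sup>2"
      by (simp add: g_def h_def norm_mult power_mult_distrib algebra_simps)
    then have "((norm (g z))\<^sup>2 + (norm (h z))\<^sup>2) powr (p / 2) = reg_power p \<delta> f (mob T z) * ((norm (H z))\<^sup>2) powr (p / 2)"
      unfolding reg_power_def by (simp add: powr_mult)
    also have "((norm (H z))\<^sup>2) powr (p / 2) = jac T z powr \<alpha>"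
      using p jac_pos[OF T z] by (simp add: sq_powr_half nH[OF z] powr_powr)
    finally show ?thesis by (simp add: pull_def)
  qed
  have hnz: "h z \<noteq> 0" if "norm z < 1" for z
  proof -
    have "0 < norm (H z)" unfolding nH[OF that] using jac_pos[OF T that] by simp
    then show ?thesis using \<delta> by (auto simp: h_def)
  qed
  let ?M = "cmean (\<lambda>z. ((norm (g z))\<^sup>2 + (norm (h z))\<^sup>2) powr (p / 2))"
  obtain K where K: "\<And>r. 0 < r \<Longrightarrow> r < 1 \<Longrightarrow> (?M has_real_derivative K r / r) (at r)"
    "mono_on {0..<1} K" "\<And>r. 0 \<le> r \<Longrightarrow> r < 1 \<Longrightarrow> 0 \<le> K r"
    by (rule pair_cmean[OF ghol hhol _ half_gt_zero[OF p]]) (use hnz in blast, rule that)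
  have "wint \<alpha> ?M \<rho> \<le> wint \<alpha> ?M \<sigma>"
  proof (rule wint_mono[where C="{}" and M'="\<lambda>r. K r / r"])
    show "continuous_on {0..<1} ?M"
      using p ghol hhol
      by (intro continuous_on_cmean continuous_on_powr' continuous_intros holomorphic_on_imp_continuous_on) auto
  qed (use \<rho> K in auto)
  moreover have "wint \<alpha> (cmean (pull \<alpha> (reg_power p \<delta> f) T)) x = wint \<alpha> ?M x" if "0 \<le> x" "x < 1" for x
    using that by (intro wint_cong cmean_cong eq) auto
  ultimately show ?thesis using \<rho> by simp
qed

lemma reg_power_bounded_gradient:
  assumes p: "0 < p" and \<delta>: "0 < \<delta>" and f: "f holomorphic_on ball 0 R" and R: "1 < R"
  obtains e B where "\<And>z. norm z < 1 \<Longrightarrow> has_grad (reg_power p \<delta> f) (e z) z" "continuous_on (ball 0 1) e"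
    "\<And>z. norm z < 1 \<Longrightarrow> \<bar>reg_power p \<delta> f z\<bar> \<le> B" "\<And>z. norm z < 1 \<Longrightarrow> norm (e z) \<le> B"
proof -
  define s where "s z = (norm (f z))\<^sup>2 + \<delta>\<^sup>2" for z
  define e where "e z = of_real (p / 2 * s z powr (p / 2 - 1)) * (2 * cnj (f z) * deriv f z)" for z
  have spos: "0 < s z" for z using \<delta> by (simp add: s_def add_nonneg_pos)
  have g: "has_grad (reg_power p \<delta> f) (e z) z" if "norm z < R" for z
  proof -
    have "(f has_field_derivative deriv f z) (at z)"
      by (rule holomorphic_derivI[OF f]) (use that in auto)
    from has_grad_add[OF has_grad_norm_sq[OF this] has_grad_const[of "\<delta>\<^sup>2"]]
    have "has_grad s (2 * cnj (f z) * deriv f z) z" by (simp add: s_def[abs_def])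
    from has_grad_powr[OF this spos, of "p / 2"] show ?thesis
      by (simp add: reg_power_def[abs_def] s_def[abs_def] e_def)
  qed
  have sub: "cball 0 1 \<subseteq> (ball 0 R :: complex set)" using R by auto
  have fc [continuous_intros]: "continuous_on (cball 0 1) f"
    using f sub by (meson continuous_on_subset holomorphic_on_imp_continuous_on)
  have "deriv f holomorphic_on ball 0 R" by (intro holomorphic_deriv f) auto
  then have dc [continuous_intros]: "continuous_on (cball 0 1) (deriv f)"
    using sub by (meson continuous_on_subset holomorphic_on_imp_continuous_on)
  have sc [continuous_intros]: "continuous_on (cball 0 1) (\<lambda>z. s z powr b)" for b
  proof (rule continuous_on_powr)
    show "continuous_on (cball 0 1) s" unfolding s_def by (intro continuous_intros)
  qed (use spos in \<open>auto simp: less_imp_neq[THEN not_sym]\<close>)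
  have ec: "continuous_on (cball 0 1) e" unfolding e_def by (intro continuous_intros)
  have uc: "continuous_on (cball 0 1) (reg_power p \<delta> f)" by (intro continuous_on_reg_power p fc)
  obtain B1 where B1: "\<And>z. z \<in> cball 0 1 \<Longrightarrow> norm (e z) \<le> B1"
    using compact_imp_bounded[OF compact_continuous_image[OF ec compact_cball]] unfolding bounded_iff by blast
  obtain B2 where B2: "\<And>z. z \<in> cball 0 1 \<Longrightarrow> norm (reg_power p \<delta> f z) \<le> B2"
    using compact_imp_bounded[OF compact_continuous_image[OF uc compact_cball]] unfolding bounded_iff by blast
  show thesis
  proof
    show "continuous_on (ball 0 1) e" using ec by (rule continuous_on_subset) auto
    show "\<bar>reg_power p \<delta> f z\<bar> \<le> max B1 B2" "norm (e z) \<le> max B1 B2" if "norm z < 1" for z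
      using B1[of z] B2[of z] that by auto
    show "has_grad (reg_power p \<delta> f) (e z) z" if "norm z < 1" for z using g[of z] that R by auto
  qed
qed

lemma weight_tendsto_0:
  assumes "0 < \<alpha>"
  shows "((\<lambda>\<sigma>. (1 - \<sigma>\<^sup>2) powr \<alpha>) \<longlongrightarrow> 0) (at_left (1::real))"
proof (rule tendsto_zero_powrI[OF _ tendsto_const _ assms])
  have "((\<lambda>\<sigma>. 1 - \<sigma>\<^sup>2) \<longlongrightarrow> 1 - 1\<^sup>2) (at_left (1::real))" by (intro tendsto_intros)
  then show "((\<lambda>\<sigma>. 1 - \<sigma>\<^sup>2) \<longlongrightarrow> 0) (at_left (1::real))" by simp
  have "\<forall>\<^sub>F \<sigma> in at_left (1::real). \<sigma> \<in> {0<..<1}" by (rule eventually_at_left_real) simp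
  then show "\<forall>\<^sub>F \<sigma> in at_left (1::real). 0 \<le> 1 - \<sigma>\<^sup>2"
    by eventually_elim (simp add: power_le_one)
qed

text \<open>
  The central estimate. The factor in front of \<open>(1 - \<tau>\<^sup>2)\<^sup>\<alpha>\<close> depends on the radii \<open>R\<close> and \<open>R'\<close> but not on
  \<open>\<delta>\<close>, so that \<open>\<delta> \<rightarrow> 0\<close> is possible for fixed \<open>\<tau>\<close>.
\<close>

lemma wint_pull_dilation_le:
  assumes \<alpha>: "0 < \<alpha>" and p: "0 < p" and \<delta>: "0 < \<delta>" "\<delta> \<le> 1" and T: "0 \<le> T" "T < 1"
    and f: "f holomorphic_on ball 0 1" and R: "0 < R" "R < R'" "R' < 1"
    and \<rho>: "0 < \<rho>" "\<rho> < 1" and \<tau>: "1 / 2 \<le> \<tau>" "\<tau> < 1"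
  shows "wint \<alpha> (cmean (pull \<alpha> (reg_power p \<delta> (\<lambda>z. f (of_real R * z))) T)) \<rho>
     \<le> wint \<alpha> (cmean (reg_power p \<delta> f)) \<tau>
       + cmean (reg_power p 1 f) R' / (R' - R) * (1 - \<tau>\<^sup>2) powr \<alpha> / (2 * \<alpha> * \<tau>\<^sup>2)"
proof -
  let ?fR = "\<lambda>z. f (of_real R * z)"
  let ?v = "reg_power p \<delta> ?fR" and ?u = "reg_power p \<delta> f"
  let ?k = "cmean (reg_power p 1 f) R' / (R' - R)"
  have fc: "continuous_on (ball 0 1) f" using f by (rule holomorphic_on_imp_continuous_on)
  have uc: "continuous_on (ball 0 1) (reg_power p \<delta> f)" for \<delta> by (intro continuous_on_reg_power p fc)
  have fR: "?fR holomorphic_on ball 0 (1 / R)"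
    by (rule holomorphic_on_compose_gen[OF _ f, unfolded o_def])
       (use R in \<open>auto intro!: holomorphic_intros simp: norm_mult field_simps\<close>)
  have "1 < 1 / R" using R by simp
  then have fR1: "?fR holomorphic_on ball 0 1"
    by (intro holomorphic_on_subset[OF fR] subset_ball) simp
  obtain K where K: "\<And>r. 0 < r \<Longrightarrow> r < 1 \<Longrightarrow> (cmean ?u has_real_derivative K r / r) (at r)"
    "mono_on {0..<1} K" "\<And>r. 0 \<le> r \<Longrightarrow> r < 1 \<Longrightarrow> 0 \<le> K r"
    by (rule reg_power_cmean[OF p \<delta>(1) f]) (rule that)
  note K1 = K(1)
  have Km: "K a \<le> K b" if "0 \<le> a" "a \<le> b" "b < 1" for a b
    using mono_onD[OF K(2), of a b] that by auto
  have Mv: "cmean ?v = (\<lambda>r. cmean ?u (R * r))"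
    by (simp add: cmean_def reg_power_def fun_eq_iff mult.assoc)
  have Kv: "(cmean ?v has_real_derivative K (R * r) / r) (at r)" if "0 < r" "r < 1" for r
  proof -
    have "0 < R * r" "R * r < 1" using R that mult_strict_mono[of R 1 r 1] by auto
    note d = K1[OF this]
    have "((\<lambda>r. cmean ?u (R * r)) has_real_derivative K (R * r) / (R * r) * R) (at r)"
      by (rule DERIV_chain2[where f="cmean ?u" and g="\<lambda>r. R * r", OF d])
        (auto intro!: derivative_eq_intros)
    then show ?thesis using R unfolding Mv by simp
  qed
  have vc: "continuous_on {0..<1} (cmean ?v)"
    by (intro continuous_on_cmean continuous_on_reg_power p holomorphic_on_imp_continuous_on fR1)
  \<comment> \<open>A bound uniform in \<open>\<delta>\<close>: by monotonicity of \<open>K\<close>, the mean grows by at least \<open>(R' - R) K(R)\<close> from \<open>R\<close> to \<open>R'\<close>.\<close>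
  have KR: "K R \<le> ?k"
  proof -
    obtain \<xi> where \<xi>: "R < \<xi>" "\<xi> < R'" "cmean ?u R' - cmean ?u R = (R' - R) * (K \<xi> / \<xi>)"
      using MVT2[of R R' "cmean ?u" "\<lambda>r. K r / r"] K1 R by auto
    have "K R \<le> K \<xi>" using Km[of R \<xi>] \<xi> R by auto
    also have "\<dots> \<le> K \<xi> / \<xi>"
    proof -
      have "K \<xi> * \<xi> \<le> K \<xi> * 1" using K(3)[of \<xi>] \<xi> R by (intro mult_left_mono) auto
      then show ?thesis using \<xi> R by (simp add: field_simps)
    qed
    also have "\<dots> = (cmean ?u R' - cmean ?u R) / (R' - R)" using \<xi> R by simp
    also have "\<dots> \<le> ?k"
    proof (rule divide_right_mono)
      have "cmean (\<lambda>z. 0) R \<le> cmean ?u R"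
        by (rule cmean_mono) (use R uc in \<open>auto simp: reg_power_nonneg\<close>)
      moreover have "cmean ?u R' \<le> cmean (reg_power p 1 f) R'"
        by (rule cmean_mono) (use R uc \<delta> p in \<open>auto intro!: reg_power_mono\<close>)
      ultimately show "cmean ?u R' - cmean ?u R \<le> cmean (reg_power p 1 f) R'" by simp
    qed (use R in auto)
    finally show ?thesis .
  qed
  obtain e B where e: "\<And>z. norm z < 1 \<Longrightarrow> has_grad ?v (e z) z" "continuous_on (ball 0 1) e"
    "\<And>z. norm z < 1 \<Longrightarrow> \<bar>?v z\<bar> \<le> B" "\<And>z. norm z < 1 \<Longrightarrow> norm (e z) \<le> B"
    by (rule reg_power_bounded_gradient[OF p \<delta>(1) fR \<open>1 < 1 / R\<close>]) (rule that)
  obtain C where C: "\<And>\<sigma>. 1 / 2 \<le> \<sigma> \<Longrightarrow> \<sigma> < 1 \<Longrightarrow>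
     wint \<alpha> (cmean (pull \<alpha> ?v T)) \<sigma> \<le> wint \<alpha> (cmean ?v) \<sigma> + C * (1 - \<sigma>\<^sup>2) powr \<alpha>"
    by (rule wint_pull_le[OF \<alpha> T e]) (assumption | rule that)+
  let ?X = "wint \<alpha> (cmean ?u) \<tau> + ?k * (1 - \<tau>\<^sup>2) powr \<alpha> / (2 * \<alpha> * \<tau>\<^sup>2)"
  have step: "wint \<alpha> (cmean (pull \<alpha> ?v T)) \<rho> \<le> ?X + C * (1 - \<sigma>\<^sup>2) powr \<alpha>"
    if \<sigma>: "\<rho> < \<sigma>" "\<tau> < \<sigma>" "\<sigma> < 1" for \<sigma>
  proof -
    have "wint \<alpha> (cmean (pull \<alpha> ?v T)) \<rho> \<le> wint \<alpha> (cmean (pull \<alpha> ?v T)) \<sigma>"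
      by (rule pull_reg_power_mono[OF \<alpha> p \<delta>(1) T fR1]) (use \<rho> \<sigma> in auto)
    also have "\<dots> \<le> wint \<alpha> (cmean ?v) \<sigma> + C * (1 - \<sigma>\<^sup>2) powr \<alpha>"
      by (rule C) (use \<tau> \<sigma> in auto)
    also have "wint \<alpha> (cmean ?v) \<sigma> \<le> wint \<alpha> (cmean ?v) \<tau> + ?k * (1 - \<tau>\<^sup>2) powr \<alpha> / (2 * \<alpha> * \<tau>\<^sup>2)"
    proof (rule wint_tail[OF \<alpha> _ _ _ vc Kv])
      show "r * (K (R * r) / r) \<le> ?k" if "r \<in> {0<..<1}" for r
      proof -
        have "K (R * r) \<le> K R" by (rule Km) (use R that mult_left_mono[of r 1 R] in auto)
        then show ?thesis using KR that by simp
      qed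
      show "0 \<le> ?k" using KR K(3)[of R] R by linarith
    qed (use \<tau> \<sigma> in auto)
    also have "wint \<alpha> (cmean ?v) \<tau> \<le> wint \<alpha> (cmean ?u) \<tau>"
    proof (rule wint_le_wint)
      show "continuous_on {0..\<tau>} (cmean ?v)" "continuous_on {0..\<tau>} (cmean ?u)"
        by (rule continuous_on_subset[OF vc] continuous_on_subset[OF continuous_on_cmean[OF uc]]; use \<tau> in auto)+
      show "K (R * r) / r \<le> K r / r" if "r \<in> {0<..<\<tau>}" for r
        by (intro divide_right_mono Km) (use that \<tau> R mult_right_mono[of R 1 r] in auto)
    qed (use \<tau> Kv K1 in \<open>auto simp: reg_power_def\<close>)
    finally show ?thesis by simp
  qed
  have lim: "((\<lambda>\<sigma>. ?X + C * (1 - \<sigma>\<^sup>2) powr \<alpha>) \<longlongrightarrow> ?X + C * 0) (at_left 1)"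
    by (intro tendsto_intros weight_tendsto_0 \<alpha>)
  have "\<forall>\<^sub>F \<sigma> in at_left 1. wint \<alpha> (cmean (pull \<alpha> ?v T)) \<rho> \<le> ?X + C * (1 - \<sigma>\<^sup>2) powr \<alpha>"
  proof -
    have "\<forall>\<^sub>F \<sigma> in at_left 1. \<sigma> \<in> {max \<rho> \<tau><..<1}"
      by (rule eventually_at_left_real) (use \<rho> \<tau> in auto)
    then show ?thesis by eventually_elim (use step in auto)
  qed
  from tendsto_lowerbound[OF lim this] show ?thesis by simp
qed


lemma reg_power_tendsto:
  assumes p: "0 < p" and "\<delta> \<longlonglongrightarrow> 0" "(\<lambda>n. f n z) \<longlonglongrightarrow> c"
  shows "(\<lambda>n. reg_power p (\<delta> n) (f n) z) \<longlonglongrightarrow> norm c powr p"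
proof -
  have "(\<lambda>n. ((norm (f n z))\<^sup>2 + (\<delta> n)\<^sup>2) powr (p / 2)) \<longlonglongrightarrow> ((norm c)\<^sup>2 + 0\<^sup>2) powr (p / 2)"
    using p by (intro tendsto_powr2 tendsto_intros assms) auto
  then show ?thesis by (simp add: reg_power_def sq_powr_half)
qed

lemma continuous_on_pull1:
  assumes T: "0 \<le> T" "T < 1" and v: "continuous_on (ball 0 1) v"
  shows "continuous_on (ball 0 1) (pull \<alpha> v T)"
  using continuous_on_compose2[OF continuous_on_pull(1)[OF T(2) v continuous_on_const, of \<alpha>], of "ball 0 1" "\<lambda>z. (T, z)"] T
  by (force intro!: continuous_intros)

lemma wint_pull_tendsto:
  assumes \<alpha>: "0 < \<alpha>" and T: "0 \<le> T" "T < 1" and \<rho>: "0 \<le> \<rho>" "\<rho> < 1"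
    and c: "\<And>n::nat. continuous_on (ball 0 1) (u n)"
    and B: "\<And>n z. z \<in> mob T ` cball 0 \<rho> \<Longrightarrow> \<bar>u n z\<bar> \<le> B"
    and lim: "\<And>z. norm z < 1 \<Longrightarrow> (\<lambda>n. u n z) \<longlonglongrightarrow> v z"
  shows "(\<lambda>n. wint \<alpha> (cmean (pull \<alpha> (u n) T)) \<rho>) \<longlonglongrightarrow> wint \<alpha> (cmean (pull \<alpha> v T)) \<rho>"
proof (rule wint_cmean_tendsto[OF \<rho>])
  show "continuous_on (ball 0 1) (pull \<alpha> (u n) T)" for n by (rule continuous_on_pull1[OF T c])
  have B0: "0 \<le> B" using B[of "mob T 0" 0] \<rho> by (force intro: order_trans[OF abs_ge_zero])
  show "\<bar>pull \<alpha> (u n) T z\<bar> \<le> B * (1 / (1 - T)\<^sup>2) powr \<alpha>" if z: "norm z \<le> \<rho>" for n z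
    unfolding pull_def abs_mult
  proof (intro mult_mono B)
    have z1: "norm z < 1" using z \<rho> by simp
    show "\<bar>jac T z powr \<alpha>\<bar> \<le> (1 / (1 - T)\<^sup>2) powr \<alpha>"
      using jac_le[of T T z] jac_pos[of T z] T z1 \<alpha> by (auto intro!: powr_mono2)
  qed (use z B0 in auto)
  show "(\<lambda>n. pull \<alpha> (u n) T z) \<longlonglongrightarrow> pull \<alpha> v T z" if "norm z \<le> \<rho>" for z
    unfolding pull_def using norm_mob_less_1[of T z] that T \<rho> by (intro tendsto_intros lim) auto
qed

lemma bounded_on_cball:
  assumes "continuous_on (ball 0 1) (f :: complex \<Rightarrow> 'a :: real_normed_vector)" "\<rho> < 1"
  obtains B where "\<And>z. norm z \<le> \<rho> \<Longrightarrow> norm (f z) \<le> B"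
proof -
  have "continuous_on (cball 0 \<rho>) f" using assms by (auto elim!: continuous_on_subset)
  then have "bounded (f ` cball 0 \<rho>)" by (intro compact_imp_bounded compact_continuous_image) auto
  then show thesis using that unfolding bounded_iff by (metis imageI mem_cball_0)
qed

text \<open>
  The limits \<open>\<delta> \<rightarrow> 0\<close> and then \<open>\<tau> \<rightarrow> 1\<close>. The remaining parameter \<open>R\<close> tends to 1 in the next lemma.
\<close>

lemma wint_pull_dilation_bound:
  assumes \<alpha>: "0 < \<alpha>" and p: "0 < p" and T: "0 \<le> T" "T < 1"
    and f: "f holomorphic_on ball 0 1" and R: "0 < R" "R < 1"
    and \<rho>: "0 < \<rho>" "\<rho> < 1"
    and S: "\<And>\<tau>. 0 < \<tau> \<Longrightarrow> \<tau> < 1 \<Longrightarrow> wint \<alpha> (cmean (\<lambda>z. norm (f z) powr p)) \<tau> \<le> S"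
  shows "wint \<alpha> (cmean (pull \<alpha> (\<lambda>z. norm (f (of_real R * z)) powr p) T)) \<rho> \<le> S"
proof -
  let ?R' = "(1 + R) / 2"
  let ?k = "cmean (reg_power p 1 f) ?R' / (?R' - R)"
  let ?fR = "\<lambda>z. f (of_real R * z)"
  let ?d = "\<lambda>n. 1 / real (Suc n)"
  have fc: "continuous_on (ball 0 1) f" using f by (rule holomorphic_on_imp_continuous_on)
  have R': "R < ?R'" "?R' < 1" using R by auto
  have d0: "?d \<longlonglongrightarrow> 0" by (rule LIMSEQ_Suc[OF lim_1_over_n])
  have Rz: "norm (of_real R * z) < R" if "norm z < 1" for z :: complex
    using that R by (simp add: norm_mult)
  have fRc: "continuous_on (ball 0 1) ?fR"
    by (rule continuous_on_compose2[OF fc]) (use Rz R in \<open>force intro!: continuous_intros\<close>)+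
  have L: "wint \<alpha> (cmean (pull \<alpha> (\<lambda>z. norm (?fR z) powr p) T)) \<rho>
      \<le> wint \<alpha> (cmean (\<lambda>z. norm (f z) powr p)) \<tau> + ?k * (1 - \<tau>\<^sup>2) powr \<alpha> / (2 * \<alpha> * \<tau>\<^sup>2)"
    if \<tau>: "1 / 2 \<le> \<tau>" "\<tau> < 1" for \<tau>
  proof (rule LIMSEQ_le)
    obtain B where B: "\<And>z. norm z \<le> R \<Longrightarrow> norm (f z) \<le> B" using bounded_on_cball[OF fc R(2)] by blast
    obtain B' where B': "\<And>z. norm z \<le> \<tau> \<Longrightarrow> norm (f z) \<le> B'" using bounded_on_cball[OF fc \<tau>(2)] by blast
    show "(\<lambda>n. wint \<alpha> (cmean (pull \<alpha> (reg_power p (?d n) ?fR) T)) \<rho>) \<longlonglongrightarrow>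
        wint \<alpha> (cmean (pull \<alpha> (\<lambda>z. norm (?fR z) powr p) T)) \<rho>"
    proof (rule wint_pull_tendsto[OF \<alpha> T, where B="(B\<^sup>2 + 1\<^sup>2) powr (p / 2)"])
      fix n z assume "z \<in> mob T ` cball 0 \<rho>"
      then have "norm z < 1" using norm_mob_less_1[OF T] \<rho> by auto
      then have "norm (?fR z) \<le> B" using B Rz by (simp add: less_imp_le)
      then show "\<bar>reg_power p (?d n) ?fR z\<bar> \<le> (B\<^sup>2 + 1\<^sup>2) powr (p / 2)"
        by (intro reg_power_bound p) auto
    next
      show "(\<lambda>n. reg_power p (?d n) ?fR z) \<longlonglongrightarrow> norm (?fR z) powr p" for z
        by (rule reg_power_tendsto[OF p d0 tendsto_const])
    qed (use \<rho> in \<open>auto intro!: continuous_on_reg_power p fRc\<close>)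
    show "(\<lambda>n. wint \<alpha> (cmean (reg_power p (?d n) f)) \<tau> + ?k * (1 - \<tau>\<^sup>2) powr \<alpha> / (2 * \<alpha> * \<tau>\<^sup>2)) \<longlonglongrightarrow>
        wint \<alpha> (cmean (\<lambda>z. norm (f z) powr p)) \<tau> + ?k * (1 - \<tau>\<^sup>2) powr \<alpha> / (2 * \<alpha> * \<tau>\<^sup>2)"
    proof (intro tendsto_add tendsto_const wint_cmean_tendsto[where B="(B'\<^sup>2 + 1\<^sup>2) powr (p / 2)"])
      fix n and z :: complex assume "norm z \<le> \<tau>"
      then show "\<bar>reg_power p (?d n) f z\<bar> \<le> (B'\<^sup>2 + 1\<^sup>2) powr (p / 2)"
        by (intro reg_power_bound p B') auto
    next
      show "(\<lambda>n. reg_power p (?d n) f z) \<longlonglongrightarrow> norm (f z) powr p" for z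
        by (rule reg_power_tendsto[OF p d0 tendsto_const])
    qed (use \<tau> in \<open>auto intro!: continuous_on_reg_power p fc\<close>)
    show "\<exists>N. \<forall>n\<ge>N. wint \<alpha> (cmean (pull \<alpha> (reg_power p (?d n) ?fR) T)) \<rho>
      \<le> wint \<alpha> (cmean (reg_power p (?d n) f)) \<tau> + ?k * (1 - \<tau>\<^sup>2) powr \<alpha> / (2 * \<alpha> * \<tau>\<^sup>2)"
      by (intro exI[of _ 0] allI impI wint_pull_dilation_le \<alpha> p T f R(1) R' \<rho> \<tau>) auto
  qed
  have lim: "((\<lambda>\<tau>. S + ?k * (1 - \<tau>\<^sup>2) powr \<alpha> / (2 * \<alpha> * \<tau>\<^sup>2)) \<longlongrightarrow> S + ?k * 0 / (2 * \<alpha> * 1\<^sup>2)) (at_left 1)"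
    by (intro tendsto_intros weight_tendsto_0 \<alpha>) (use \<alpha> in auto)
  have "\<forall>\<^sub>F \<tau> in at_left 1. wint \<alpha> (cmean (pull \<alpha> (\<lambda>z. norm (?fR z) powr p) T)) \<rho> \<le> S + ?k * (1 - \<tau>\<^sup>2) powr \<alpha> / (2 * \<alpha> * \<tau>\<^sup>2)"
  proof -
    have "\<forall>\<^sub>F \<tau> in at_left 1. \<tau> \<in> {1 / 2<..<1::real}" by (rule eventually_at_left_real) simp
    then show ?thesis
    proof eventually_elim
      case (elim \<tau>)
      then show ?case using L[of \<tau>] S[of \<tau>] by auto
    qed
  qed
  from tendsto_lowerbound[OF lim this] show ?thesis by simp
qed

lemma wint_pull_bound:
  assumes \<alpha>: "0 < \<alpha>" and p: "0 < p" and T: "0 \<le> T" "T < 1"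
    and f: "f holomorphic_on ball 0 1" and \<rho>: "0 < \<rho>" "\<rho> < 1"
    and S: "\<And>\<tau>. 0 < \<tau> \<Longrightarrow> \<tau> < 1 \<Longrightarrow> wint \<alpha> (cmean (\<lambda>z. norm (f z) powr p)) \<tau> \<le> S"
  shows "wint \<alpha> (cmean (pull \<alpha> (\<lambda>z. norm (f z) powr p) T)) \<rho> \<le> S"
proof (rule LIMSEQ_le_const2)
  let ?R = "\<lambda>n. 1 - 1 / real (Suc (Suc n))"
  have fc: "continuous_on (ball 0 1) f" using f by (rule holomorphic_on_imp_continuous_on)
  have R: "0 < ?R n" "?R n < 1" for n by auto
  have "(\<lambda>n. 1 / real (Suc (Suc n))) \<longlonglongrightarrow> 0" by (intro LIMSEQ_Suc[OF LIMSEQ_Suc[OF lim_1_over_n]])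
  from tendsto_diff[OF tendsto_const[of 1] this] have R1: "?R \<longlonglongrightarrow> 1" by simp
  have "compact (mob T ` cball 0 \<rho>)"
    using holomorphic_on_imp_continuous_on[OF mob_holomorphic[OF T]] \<rho>
    by (intro compact_continuous_image) (auto elim!: continuous_on_subset)
  moreover have "mob T ` cball 0 \<rho> \<noteq> {}" using \<rho> by auto
  ultimately obtain x where x: "x \<in> mob T ` cball 0 \<rho>" "\<And>y. y \<in> mob T ` cball 0 \<rho> \<Longrightarrow> norm y \<le> norm x"
    using continuous_attains_sup[of "mob T ` cball 0 \<rho>" norm] by (auto intro: continuous_intros)
  have "norm x < 1" using x(1) norm_mob_less_1[OF T] \<rho> by auto
  then obtain B where B: "\<And>z. norm z \<le> norm x \<Longrightarrow> norm (f z) \<le> B" using bounded_on_cball[OF fc] by blast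
  have Rz: "norm (of_real (?R n) * z) \<le> norm z" for n and z :: complex
    unfolding norm_mult norm_of_real using R[of n] by (simp add: mult_left_le_one_le)
  show "(\<lambda>n. wint \<alpha> (cmean (pull \<alpha> (\<lambda>z. norm (f (of_real (?R n) * z)) powr p) T)) \<rho>) \<longlonglongrightarrow>
    wint \<alpha> (cmean (pull \<alpha> (\<lambda>z. norm (f z) powr p) T)) \<rho>"
  proof (rule wint_pull_tendsto[OF \<alpha> T, where B="B powr p"])
    show "continuous_on (ball 0 1) (\<lambda>z. norm (f (of_real (?R n) * z)) powr p)" for n
    proof (intro continuous_on_powr' continuous_intros)
      show "continuous_on (ball 0 1) (\<lambda>z. f (of_real (?R n) * z))"
      proof (rule continuous_on_compose2[OF fc])
        show "(\<lambda>z :: complex. of_real (?R n) * z) ` ball 0 1 \<subseteq> ball 0 1"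
          by (rule image_subsetI) (simp only: mem_ball_0 order.strict_trans1[OF Rz])
      qed (intro continuous_intros)
    qed (use p in auto)
    show "\<bar>norm (f (of_real (?R n) * z)) powr p\<bar> \<le> B powr p" if "z \<in> mob T ` cball 0 \<rho>" for n z
      using B[OF order_trans[OF Rz x(2)[OF that]], of n] p by (simp add: powr_mono2)
    show "(\<lambda>n. norm (f (of_real (?R n) * z)) powr p) \<longlonglongrightarrow> norm (f z) powr p" if z: "norm z < 1" for z
    proof (intro tendsto_powr2 tendsto_norm tendsto_const p)
      have "isCont f (of_real 1 * z)" using fc z by (simp add: continuous_on_eq_continuous_at)
      from isCont_tendsto_compose[OF this tendsto_mult[OF tendsto_of_real[OF R1] tendsto_const[of z]]]
      show "(\<lambda>n. f (of_real (?R n) * z)) \<longlonglongrightarrow> f z" by simp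
    qed auto
  qed (use \<rho> in auto)
  show "\<exists>N. \<forall>n\<ge>N. wint \<alpha> (cmean (pull \<alpha> (\<lambda>z. norm (f (of_real (?R n) * z)) powr p) T)) \<rho> \<le> S"
    by (intro exI[of _ 0] allI impI wint_pull_dilation_bound \<alpha> p T f R \<rho> S)
qed

section \<open>The norm and its invariance\<close>

lemma mean_pow_eq_cmean:
  assumes "0 < p" "continuous_on (ball 0 1) f" "\<bar>r\<bar> < 1"
  shows "mean_pow p r f = cmean (\<lambda>z. norm (f z) powr p) r"
proof -
  have "continuous_on {0..2*pi} (\<lambda>\<theta>. norm (f (of_real r * cis \<theta>)) powr p)"
    using assms by (intro continuous_on_circle[where u="\<lambda>z. norm (f z) powr p"] continuous_on_powr' continuous_intros) auto
  then have c: "continuous_on {0..2*pi} (\<lambda>\<theta>. norm (f (of_real r * exp (\<i> * of_real \<theta>))) powr p / (2 * pi))"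
    unfolding cis_conv_exp by (rule continuous_on_divide) auto
  have "set_integrable lborel {0..2*pi} (\<lambda>\<theta>. norm (f (of_real r * exp (\<i> * of_real \<theta>))) powr p / (2 * pi))"
    by (rule borel_integrable_atLeastAtMost'[OF c])
  from set_borel_integral_eq_integral(2)[OF this]
  show ?thesis by (simp add: mean_pow_def cmean_def cis_conv_exp)
qed

lemma cmean_norm_powr_mono:
  assumes p: "0 < p" and f: "f holomorphic_on ball 0 1" and ab: "0 \<le> a" "a \<le> b" "b < 1"
  shows "cmean (\<lambda>z. norm (f z) powr p) a \<le> cmean (\<lambda>z. norm (f z) powr p) b"
proof -
  let ?d = "\<lambda>n. 1 / real (Suc n)"
  have fc: "continuous_on (ball 0 1) f" using f by (rule holomorphic_on_imp_continuous_on)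
  have d0: "?d \<longlonglongrightarrow> 0" by (rule LIMSEQ_Suc[OF lim_1_over_n])
  obtain B where B: "\<And>z. norm z \<le> b \<Longrightarrow> norm (f z) \<le> B" using bounded_on_cball[OF fc ab(3)] by blast
  have lim: "(\<lambda>n. cmean (reg_power p (?d n) f) r) \<longlonglongrightarrow> cmean (\<lambda>z. norm (f z) powr p) r" if r: "0 \<le> r" "r \<le> b" for r
  proof (rule cmean_tendsto)
    show "\<bar>reg_power p (?d n) f z\<bar> \<le> (B\<^sup>2 + 1\<^sup>2) powr (p / 2)" if "norm z = \<bar>r\<bar>" for n z
      by (rule reg_power_bound[OF p]) (use that r B in auto)
    show "(\<lambda>n. reg_power p (?d n) f z) \<longlonglongrightarrow> norm (f z) powr p" for z
      by (rule reg_power_tendsto[OF p d0 tendsto_const])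
  qed (use r ab in \<open>auto intro!: continuous_on_reg_power p fc\<close>)
  have le: "cmean (reg_power p \<delta> f) a \<le> cmean (reg_power p \<delta> f) b" if \<delta>: "0 < \<delta>" for \<delta>
  proof -
    obtain K where K: "\<And>r. 0 < r \<Longrightarrow> r < 1 \<Longrightarrow> (cmean (reg_power p \<delta> f) has_real_derivative K r / r) (at r)"
      "mono_on {0..<1} K" "\<And>r. 0 \<le> r \<Longrightarrow> r < 1 \<Longrightarrow> 0 \<le> K r"
      by (rule reg_power_cmean[OF p \<delta> f]) (rule that)
    show ?thesis
    proof (rule DERIV_nonneg_imp_increasing_open[OF ab(2)])
      show "\<exists>y. (cmean (reg_power p \<delta> f) has_real_derivative y) (at x) \<and> 0 \<le> y" if "a < x" "x < b" for x
        using K(1)[of x] K(3)[of x] that ab by (intro exI[of _ "K x / x"]) auto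
      show "continuous_on {a..b} (cmean (reg_power p \<delta> f))"
        by (rule continuous_on_subset[OF continuous_on_cmean[OF continuous_on_reg_power[OF p fc]]]) (use ab in auto)
    qed
  qed
  show ?thesis
    by (rule LIMSEQ_le[OF lim lim]) (use ab le in auto)
qed

text \<open>
  The circle means of \<open>|f|\<^sup>p\<close> are differentiable at each radius whose circle contains no zero of \<open>f\<close>. The
  exceptional radii accumulate at most at 1, and they are negligible for the norm.
\<close>

lemma cmean_norm_powr_deriv:
  assumes p: "0 < p" and f: "f holomorphic_on ball 0 1"
  obtains C where "\<And>\<sigma>. \<sigma> < 1 \<Longrightarrow> finite (C \<inter> {0..\<sigma>})" "countable C"
    "\<And>r. r \<in> {0<..<1} - C \<Longrightarrow>
       (cmean (\<lambda>z. norm (f z) powr p) has_real_derivative deriv (cmean (\<lambda>z. norm (f z) powr p)) r) (at r)"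
    "\<And>r. r \<in> {0<..<1} - C \<Longrightarrow> 0 \<le> deriv (cmean (\<lambda>z. norm (f z) powr p)) r"
proof -
  let ?M = "cmean (\<lambda>z. norm (f z) powr p)"
  have nonneg: "0 \<le> deriv ?M r" if "(?M has_real_derivative deriv ?M r) (at r)" "r \<in> {0<..<1}" for r
  proof (rule mono_on_imp_deriv_nonneg[OF _ that(1)])
    show "mono_on {0<..<1} ?M" by (auto intro!: mono_onI cmean_norm_powr_mono[OF p f])
  qed (use that in auto)
  have "\<exists>C. (\<forall>\<sigma><1. finite (C \<inter> {0..\<sigma>})) \<and> countable C \<and>
    (\<forall>r\<in>{0<..<1} - C. (?M has_real_derivative deriv ?M r) (at r))"
  proof (cases "f constant_on ball 0 1")
    case True
    then obtain c where c: "\<And>z. z \<in> ball 0 1 \<Longrightarrow> f z = c" by (auto simp: constant_on_def)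
    have "(cmean (\<lambda>z. norm (f z) powr p) has_real_derivative 0) (at r)" if r: "r \<in> {0<..<1}" for r
    proof (rule has_field_derivative_transform_within_open[of "\<lambda>_. norm c powr p" _ _ "{0<..<1}"])
      show "norm c powr p = cmean (\<lambda>z. norm (f z) powr p) x" if "x \<in> {0<..<1}" for x
        using that c cmean_cong[of x "\<lambda>z. norm (f z) powr p" "\<lambda>_. norm c powr p"] by simp
    qed (use r in auto)
    then have "(?M has_real_derivative deriv ?M r) (at r)" if "r \<in> {0<..<1}" for r
      using that DERIV_imp_deriv by metis
    then show ?thesis by (intro exI[of _ "{}"]) auto
  next
    case False
    define C where "C = norm ` {z \<in> ball 0 1. f z = 0}"
    have fin: "finite (C \<inter> {0..\<sigma>})" if "\<sigma> < 1" for \<sigma>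
    proof -
      have "finite {z \<in> cball 0 \<sigma>. f z = 0}"
        by (rule holomorphic_compact_finite_zeros[OF f]) (use that False in auto)
      then have "finite (norm ` {z \<in> cball 0 \<sigma>. f z = 0})" by simp
      then show ?thesis by (rule rev_finite_subset) (auto simp: C_def)
    qed
    have "C = (\<Union>n. C \<inter> {0..1 - 1 / real (Suc n)})"
    proof safe
      fix x assume x: "x \<in> C"
      then have "x < 1" by (auto simp: C_def)
      then obtain n where "1 / real (Suc n) < 1 - x" using reals_Archimedean[of "1 - x"] by (auto simp: divide_inverse)
      then show "x \<in> (\<Union>n. C \<inter> {0..1 - 1 / real (Suc n)})"
        using x by (auto simp: C_def intro!: exI[of _ n])
    qed
    moreover have "countable (\<Union>n. C \<inter> {0..1 - 1 / real (Suc n)})"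
      by (rule countable_UN) (simp, rule countable_finite, rule fin, simp)
    ultimately have count: "countable C" by simp
    have "(cmean (\<lambda>z. norm (f z) powr p) has_real_derivative deriv (cmean (\<lambda>z. norm (f z) powr p)) r) (at r)"
      if r: "r \<in> {0<..<1} - C" for r
    proof -
      obtain d where d: "d > 0" "\<And>x. x \<in> C \<inter> {0..(1 + r) / 2} \<Longrightarrow> x \<noteq> r \<Longrightarrow> d \<le> dist r x"
        using finite_set_avoid[OF fin[of "(1 + r) / 2"], of r] r by auto
      define b where "b = min (r + d) ((1 + r) / 2)"
      have rb: "r < b" "b < 1" using r d by (auto simp: b_def min_def)
      have nz: "f z \<noteq> 0" if "r - d < norm z" "norm z < b" for z
      proof
        assume "f z = 0"
        then have zC: "norm z \<in> C" using that rb by (auto simp: C_def)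
        moreover have "norm z \<in> {0..(1 + r) / 2}" "norm z \<noteq> r" using that zC r by (auto simp: b_def)
        ultimately have "d \<le> dist r (norm z)" by (intro d(2)) auto
        moreover have "dist r (norm z) < d" using that by (auto simp: b_def dist_real_def abs_if)
        ultimately show False by simp
      qed
      let ?A = "{z :: complex. r - d < norm z \<and> norm z < b}"
      have sub: "?A \<subseteq> ball 0 1" using rb by auto
      let ?e = "\<lambda>z. of_real (p / 2 * ((norm (f z))\<^sup>2) powr (p / 2 - 1)) * (2 * cnj (f z) * deriv f z)"
      have "(cmean (\<lambda>z. ((norm (f z))\<^sup>2) powr (p / 2)) has_real_derivative
         cmean (\<lambda>z. Re (?e z * z)) r / r) (at r)"
      proof (rule has_derivative_cmean)
        show "has_grad (\<lambda>z. ((norm (f z))\<^sup>2) powr (p / 2)) (?e z) z" if "r - d < norm z" "norm z < b" for z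
        proof (rule has_grad_powr[OF has_grad_norm_sq])
          show "(f has_field_derivative deriv f z) (at z)"
            by (rule holomorphic_derivI[OF f]) (use that rb in auto)
        qed (use nz that in auto)
        have "continuous_on ?A f" "continuous_on ?A (deriv f)"
          by (intro holomorphic_on_imp_continuous_on holomorphic_on_subset[OF _ sub] f holomorphic_deriv open_ball)+
        then show "continuous_on ?A ?e"
          using nz by (intro continuous_intros) auto
      qed (use r rb d in auto)
      then show ?thesis by (simp add: sq_powr_half DERIV_imp_deriv)
    qed
    then show ?thesis using fin count by blast
  qed
  then obtain C where C: "\<And>\<sigma>. \<sigma> < 1 \<Longrightarrow> finite (C \<inter> {0..\<sigma>})" "countable C"
    "\<And>r. r \<in> {0<..<1} - C \<Longrightarrow> (?M has_real_derivative deriv ?M r) (at r)"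
    by blast
  show thesis
    by (rule that[OF C]) (use C(3) nonneg in auto)
qed

text \<open>
  The norm depends on \<open>f\<close> only through the values of \<open>|f|\<close> in the disc. The supremum runs over the sequence
  \<open>\<rho>\<^sub>n = 1 - 1 / (n + 2)\<close>.
\<close>

lemma A_norm_pow_eq_SUP:
  assumes p: "0 < p" and f: "f holomorphic_on ball 0 1"
  shows "A_norm_pow \<alpha> p f =
    (SUP n. ennreal (wint \<alpha> (cmean (\<lambda>z. norm (f z) powr p)) (1 - 1 / real (Suc (Suc n)))))"
proof -
  let ?M = "cmean (\<lambda>z. norm (f z) powr p)"
  let ?\<rho> = "\<lambda>n. 1 - 1 / real (Suc (Suc n))"
  have fc: "continuous_on (ball 0 1) f" using f by (rule holomorphic_on_imp_continuous_on)
  obtain C where C: "\<And>\<sigma>. \<sigma> < 1 \<Longrightarrow> finite (C \<inter> {0..\<sigma>})" "countable C"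
    and D: "\<And>r. r \<in> {0<..<1} - C \<Longrightarrow> (?M has_real_derivative deriv ?M r) (at r)"
    and D0: "\<And>r. r \<in> {0<..<1} - C \<Longrightarrow> 0 \<le> deriv ?M r"
    by (rule cmean_norm_powr_deriv[OF p f]) (rule that; assumption)
  define g where "g r = (if r \<in> {0<..<1} - C then deriv ?M r else 0) * (1 - r\<^sup>2) powr (\<alpha> - 1)" for r
  have g0: "0 \<le> g r" for r using D0 by (auto simp: g_def)
  have Mc: "continuous_on {0..<1} ?M"
    using p by (intro continuous_on_cmean continuous_on_powr' continuous_intros fc) auto
  have I: "(g has_integral (wint \<alpha> ?M \<rho> - ?M 0)) {0..\<rho>}" if "0 \<le> \<rho>" "\<rho> < 1" for \<rho>
    unfolding g_def
  proof (rule wint_has_integral[OF that _ C(1)[OF that(2)]])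
    show "continuous_on {0..\<rho>} ?M" by (rule continuous_on_subset[OF Mc]) (use that in auto)
    show "(?M has_real_derivative (if r \<in> {0<..<1} - C then deriv ?M r else 0)) (at r)"
      if r: "r \<in> {0<..<\<rho>} - C \<inter> {0..\<rho>}" for r
    proof -
      have "r \<in> {0<..<1} - C" using r \<open>\<rho> < 1\<close> by auto
      then show ?thesis using D[of r] by simp
    qed
  qed
  have \<rho>: "0 \<le> ?\<rho> n" "?\<rho> n < 1" for n by auto
  have "(\<integral>\<^sup>+ r\<in>{0<..<1}. ennreal (deriv (\<lambda>s. mean_pow p s f) r * (1 - r\<^sup>2) powr (\<alpha> - 1)) \<partial>lborel)
      = (\<integral>\<^sup>+ r. (SUP n. ennreal (g r) * indicator {0..?\<rho> n} r) \<partial>lborel)"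
  proof (rule nn_integral_cong_AE)
    \<comment> \<open>The radius 0 belongs to \<open>[0, \<rho>\<^sub>n]\<close> but not to the interval of integration in the norm.\<close>
    have "AE r in lborel. r \<notin> insert 0 C"
      using C(2) by (intro AE_not_in countable_imp_null_set_lborel) simp
    then show "AE r in lborel. ennreal (deriv (\<lambda>s. mean_pow p s f) r * (1 - r\<^sup>2) powr (\<alpha> - 1)) * indicator {0<..<1} r
       = (SUP n. ennreal (g r) * indicator {0..?\<rho> n} r)"
    proof eventually_elim
      case (elim r)
      show ?case
      proof (cases "r \<in> {0<..<1}")
        case True
        have "deriv (\<lambda>s. mean_pow p s f) r = deriv ?M r"
        proof (rule deriv_cong_ev)
          have "\<forall>\<^sub>F s in nhds r. s \<in> {0<..<1}" using True by (intro eventually_nhds_in_open) auto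
          then show "\<forall>\<^sub>F s in nhds r. mean_pow p s f = ?M s"
            by eventually_elim (auto intro!: mean_pow_eq_cmean p fc)
        qed simp
        then have *: "deriv (\<lambda>s. mean_pow p s f) r * (1 - r\<^sup>2) powr (\<alpha> - 1) = g r"
          using elim True by (simp add: g_def)
        obtain n where "1 / real (Suc n) < 1 - r"
          using reals_Archimedean[of "1 - r"] True by (auto simp: divide_inverse)
        moreover have "1 / real (Suc (Suc n)) \<le> 1 / real (Suc n)" by (intro frac_le) auto
        ultimately have n: "r \<in> {0..?\<rho> n}" using True by auto
        have "(SUP n. ennreal (g r) * indicator {0..?\<rho> n} r) = ennreal (g r)"
        proof (rule antisym)
          show "(SUP n. ennreal (g r) * indicator {0..?\<rho> n} r) \<le> ennreal (g r)"
            by (rule SUP_least) (auto simp: indicator_def)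
          show "ennreal (g r) \<le> (SUP n. ennreal (g r) * indicator {0..?\<rho> n} r)"
            by (rule SUP_upper2[of n]) (use n in auto)
        qed
        then show ?thesis using True * by simp
      next
        case False
        have "r \<notin> {0..?\<rho> n}" for n
        proof
          assume "r \<in> {0..?\<rho> n}"
          then have "0 \<le> r" "r < 1" using \<rho>(2)[of n] by (simp_all only: atLeastAtMost_iff) linarith
          with False elim show False by auto
        qed
        then show ?thesis using False by simp
      qed
    qed
  qed
  \<comment> \<open>Henstock-Kurzweil integrability gives Lebesgue measurability of \<open>g\<close>, not Borel measurability.\<close>
  also have "\<dots> = (\<integral>\<^sup>+ r. (SUP n. ennreal (g r) * indicator {0..?\<rho> n} r) \<partial>lebesgue)"
    by (simp only: nn_integral_completion)
  also have "\<dots> = (SUP n. (\<integral>\<^sup>+ r. ennreal (g r) * indicator {0..?\<rho> n} r \<partial>lebesgue))"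
  proof (rule nn_integral_monotone_convergence_SUP)
    show "incseq (\<lambda>n r. ennreal (g r) * indicator {0..?\<rho> n} r)"
    proof (intro incseq_SucI le_funI mult_left_mono)
      fix n x
      have "1 / real (Suc (Suc (Suc n))) \<le> 1 / real (Suc (Suc n))" by (intro frac_le) auto
      then show "indicator {0..?\<rho> n} x \<le> (indicator {0..?\<rho> (Suc n)} x :: ennreal)"
        by (auto simp: indicator_def)
    qed simp
    show "(\<lambda>r. ennreal (g r) * indicator {0..?\<rho> n} r) \<in> borel_measurable lebesgue" for n
    proof -
      have "(\<lambda>r. g r * indicator {0..?\<rho> n} r) \<in> borel_measurable lebesgue"
        by (rule has_integral_implies_lebesgue_measurable_real[OF I[OF \<rho>]])
      then have "(\<lambda>r. ennreal (g r * indicator {0..?\<rho> n} r)) \<in> borel_measurable lebesgue" by measurable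
      moreover have "ennreal (g r * indicator {0..?\<rho> n} r) = ennreal (g r) * indicator {0..?\<rho> n} r" for r
        by (auto simp: indicator_def)
      ultimately show ?thesis by simp
    qed
  qed
  also have "\<dots> = (SUP n. ennreal (wint \<alpha> ?M (?\<rho> n) - ?M 0))"
    unfolding nn_integral_completion using nn_integral_has_integral_lebesgue'[OF g0 I[OF \<rho>]] by simp
  finally have "A_norm_pow \<alpha> p f = ennreal (?M 0) + (SUP n. ennreal (wint \<alpha> ?M (?\<rho> n) - ?M 0))"
    by (simp add: A_norm_pow_def)
  also have "\<dots> = (SUP n. ennreal (?M 0) + ennreal (wint \<alpha> ?M (?\<rho> n) - ?M 0))"
    by (simp add: ennreal_SUP_add_right)
  also have "\<dots> = (SUP n. ennreal (wint \<alpha> ?M (?\<rho> n)))"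
  proof (rule SUP_cong)
    fix n
    have "0 \<le> wint \<alpha> ?M (?\<rho> n) - ?M 0" using has_integral_nonneg[OF I[OF \<rho>]] g0 by simp
    then show "ennreal (?M 0) + ennreal (wint \<alpha> ?M (?\<rho> n) - ?M 0) = ennreal (wint \<alpha> ?M (?\<rho> n))"
      by (subst ennreal_plus[symmetric]) auto
  qed simp
  finally show ?thesis .
qed

lemma wint_norm_powr_mono:
  assumes p: "0 < p" and f: "f holomorphic_on ball 0 1" and \<rho>: "0 \<le> \<rho>" "\<rho> \<le> \<sigma>" "\<sigma> < 1"
  shows "wint \<alpha> (cmean (\<lambda>z. norm (f z) powr p)) \<rho> \<le> wint \<alpha> (cmean (\<lambda>z. norm (f z) powr p)) \<sigma>"
proof -
  let ?M = "cmean (\<lambda>z. norm (f z) powr p)"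
  have fc: "continuous_on (ball 0 1) f" using f by (rule holomorphic_on_imp_continuous_on)
  obtain C where C: "\<And>\<sigma>. \<sigma> < 1 \<Longrightarrow> finite (C \<inter> {0..\<sigma>})"
    and D: "\<And>r. r \<in> {0<..<1} - C \<Longrightarrow> (?M has_real_derivative deriv ?M r) (at r)"
    and D0: "\<And>r. r \<in> {0<..<1} - C \<Longrightarrow> 0 \<le> deriv ?M r"
    by (rule cmean_norm_powr_deriv[OF p f]) (rule that; assumption)
  have Mc: "continuous_on {0..<1} ?M"
    using p by (intro continuous_on_cmean continuous_on_powr' continuous_intros fc) auto
  show ?thesis by (rule wint_mono[OF \<rho> Mc C D D0])
qed

lemma disc_denominator:
  fixes w z :: complex
  assumes "norm w < 1" "norm z < 1"
  shows "0 < Re (1 - cnj w * z)"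
proof -
  have "\<bar>Re (cnj w * z)\<bar> \<le> norm (cnj w * z)" by (rule abs_Re_le_cmod)
  also have "\<dots> < 1 * 1" unfolding norm_mult using assms by (intro mult_strict_mono') auto
  finally show ?thesis by simp
qed

lemma disc_involution:
  fixes w z :: complex
  assumes w: "norm w < 1" and z: "norm z < 1"
  defines "y \<equiv> (w - z) / (1 - cnj w * z)"
  shows "norm y < 1" "(w - y) / (1 - cnj w * y) = z"
    "1 - cnj w * y = of_real (1 - (norm w)\<^sup>2) / (1 - cnj w * z)"
proof -
  have nz: "1 - cnj w * z \<noteq> 0" using disc_denominator[OF w z] by (metis less_irrefl zero_complex.sel(1))
  have W: "0 < 1 - (norm w)\<^sup>2" using one_minus_sq_pos[of "norm w" "norm w"] w by simp
  then have W0: "of_real (1 - (norm w)\<^sup>2) \<noteq> (0 :: complex)" by (simp only: of_real_eq_0_iff)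
  have ww: "of_real (1 - (norm w)\<^sup>2) = 1 - cnj w * w"
    unfolding of_real_diff complex_norm_square by (simp add: mult.commute)
  show 3: "1 - cnj w * y = of_real (1 - (norm w)\<^sup>2) / (1 - cnj w * z)"
    unfolding ww y_def using nz by (simp add: field_simps)
  have "w - y = of_real (1 - (norm w)\<^sup>2) * z / (1 - cnj w * z)"
    unfolding ww y_def using nz by (simp add: field_simps)
  then show "(w - y) / (1 - cnj w * y) = z"
    unfolding 3 using nz W0 by (simp add: field_simps)
  have "(norm (1 - cnj w * z))\<^sup>2 - (norm (w - z))\<^sup>2 = (1 - (norm w)\<^sup>2) * (1 - (norm z)\<^sup>2)"
    unfolding cmod_power2 by (simp add: power2_eq_square algebra_simps)
  moreover have "0 < 1 - (norm z)\<^sup>2" using one_minus_sq_pos[of "norm z" "norm z"] z by simp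
  ultimately have "(norm (w - z))\<^sup>2 < (norm (1 - cnj w * z))\<^sup>2" using W by (smt (verit) mult_pos_pos)
  then have "norm (w - z) < norm (1 - cnj w * z)" by (rule power2_less_imp_less) simp
  then show "norm y < 1" unfolding y_def norm_divide using nz by simp
qed

lemma norm_T_op:
  assumes w: "norm w < 1" and z: "norm z < 1"
  shows "norm (T_op w \<kappa> f z) =
    norm (f ((w - z) / (1 - cnj w * z))) * ((1 - (norm w)\<^sup>2) / (norm (1 - cnj w * z))\<^sup>2) powr \<kappa>"
proof -
  have nz: "1 - cnj w * z \<noteq> 0" using disc_denominator[OF w z] by (metis less_irrefl zero_complex.sel(1))
  have "0 < 1 - (norm w)\<^sup>2" using one_minus_sq_pos[of "norm w" "norm w"] w by simp
  from norm_weight_factor[OF this nz, of \<kappa>] show ?thesis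
    unfolding T_op_def norm_mult by simp
qed

lemma norm_T_op_T_op:
  assumes w: "norm w < 1" and z: "norm z < 1"
  shows "norm (T_op w \<kappa> (T_op w \<kappa> f) z) = norm (f z)"
proof -
  define y where "y = (w - z) / (1 - cnj w * z)"
  have nz: "1 - cnj w * z \<noteq> 0" using disc_denominator[OF w z] by (metis less_irrefl zero_complex.sel(1))
  note y = disc_involution[OF w z, folded y_def]
  have W: "0 < 1 - (norm w)\<^sup>2" using one_minus_sq_pos[of "norm w" "norm w"] w by simp
  have n: "norm (1 - cnj w * y) = (1 - (norm w)\<^sup>2) / norm (1 - cnj w * z)"
    unfolding y(3) norm_divide norm_of_real using W by simp
  have "norm (T_op w \<kappa> (T_op w \<kappa> f) z) = norm (f z) *
     (((1 - (norm w)\<^sup>2) / (norm (1 - cnj w * y))\<^sup>2) powr \<kappa> * ((1 - (norm w)\<^sup>2) / (norm (1 - cnj w * z))\<^sup>2) powr \<kappa>)"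
    by (simp only: norm_T_op[OF w z] y_def[symmetric] norm_T_op[OF w y(1)] y(2) mult.assoc)
  also have "((1 - (norm w)\<^sup>2) / (norm (1 - cnj w * y))\<^sup>2) powr \<kappa> * ((1 - (norm w)\<^sup>2) / (norm (1 - cnj w * z))\<^sup>2) powr \<kappa>
      = (((1 - (norm w)\<^sup>2) / (norm (1 - cnj w * y))\<^sup>2) * ((1 - (norm w)\<^sup>2) / (norm (1 - cnj w * z))\<^sup>2)) powr \<kappa>"
    by (simp only: powr_mult)
  also have "((1 - (norm w)\<^sup>2) / (norm (1 - cnj w * y))\<^sup>2) * ((1 - (norm w)\<^sup>2) / (norm (1 - cnj w * z))\<^sup>2) = 1"
    unfolding n using W nz by (simp add: power_divide) (simp add: power2_eq_square)
  finally show ?thesis by simp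
qed

lemma T_op_holomorphic:
  assumes w: "norm w < 1" and f: "f holomorphic_on ball 0 1"
  shows "T_op w \<kappa> f holomorphic_on ball 0 1"
proof -
  have Re: "0 < Re (1 - cnj w * z)" if "z \<in> ball 0 1" for z using disc_denominator[OF w] that by simp
  have nz: "1 - cnj w * z \<noteq> 0" if "z \<in> ball 0 1" for z using Re[OF that] by (metis less_irrefl zero_complex.sel(1))
  have np: "1 - cnj w * z \<notin> \<real>\<^sub>\<le>\<^sub>0" if "z \<in> ball 0 1" for z
    using Re[OF that] by (auto simp: complex_nonpos_Reals_iff)
  have "(\<lambda>z. (w - z) / (1 - cnj w * z)) holomorphic_on ball 0 1"
    using nz by (intro holomorphic_intros) auto
  then have "(\<lambda>z. f ((w - z) / (1 - cnj w * z))) holomorphic_on ball 0 1"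
    by (rule holomorphic_on_compose_gen[OF _ f, unfolded o_def]) (use disc_involution(1)[OF w] in auto)
  moreover have "(\<lambda>z. of_real ((1 - (norm w)\<^sup>2) powr \<kappa>) / (1 - cnj w * z) powr of_real (2 * \<kappa>)) holomorphic_on ball 0 1"
    using nz np by (intro holomorphic_intros) auto
  ultimately show ?thesis
    unfolding T_op_def[abs_def] by (rule holomorphic_on_mult)
qed

text \<open>
  Writing \<open>w = t a\<close> with \<open>t = |w|\<close> and \<open>|a| = 1\<close>, the operator is the pullback by \<open>\<phi>\<^sub>t\<close> of \<open>f(a z)\<close>, taken at
  \<open>- cnj a * z\<close>; circle means ignore both rotations.
\<close>

lemma wint_T_op_bound:
  assumes \<alpha>: "0 < \<alpha>" and p: "0 < p" and f: "f holomorphic_on ball 0 1" and w: "norm w < 1"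
    and \<rho>: "0 < \<rho>" "\<rho> < 1"
    and S: "\<And>\<tau>. 0 < \<tau> \<Longrightarrow> \<tau> < 1 \<Longrightarrow> wint \<alpha> (cmean (\<lambda>z. norm (f z) powr p)) \<tau> \<le> S"
  shows "wint \<alpha> (cmean (\<lambda>z. norm (T_op w (\<alpha> / p) f z) powr p)) \<rho> \<le> S"
proof -
  define T where "T = norm w"
  have T: "0 \<le> T" "T < 1" using w by (auto simp: T_def)
  obtain a where a: "norm a = 1" "w = of_real T * a"
  proof (cases "w = 0")
    case True
    then show thesis using that[of 1] by (simp add: T_def)
  next
    case False
    have "w = of_real T * sgn w" using False by (simp add: T_def sgn_div_norm scaleR_conv_of_real)
    with False show thesis using that[of "sgn w"] by (simp add: norm_sgn)
  qed
  have aa: "a * cnj a = 1" using complex_norm_square[of a] a(1) by simp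
  let ?fa = "\<lambda>z. f (a * z)"
  have fc: "continuous_on (ball 0 1) f" using f by (rule holomorphic_on_imp_continuous_on)
  have fac: "?fa holomorphic_on ball 0 1"
    by (rule holomorphic_on_compose_gen[OF _ f, unfolded o_def])
       (auto intro!: holomorphic_intros simp: norm_mult a(1))
  have cc: "continuous_on (ball 0 1) (\<lambda>z. norm (g z) powr p)" if "continuous_on (ball 0 1) g" for g :: "complex \<Rightarrow> complex"
    using p by (intro continuous_on_powr' continuous_intros that) auto
  have eq1: "wint \<alpha> (cmean (\<lambda>z. norm (?fa z) powr p)) t = wint \<alpha> (cmean (\<lambda>z. norm (f z) powr p)) t" if "0 < t" "t < 1" for t
    by (rule wint_cong) (use that cmean_rotate[OF cc[OF fc] _ a(1)] in auto)
  have key: "norm (T_op w (\<alpha> / p) f z) powr p = pull \<alpha> (\<lambda>z. norm (?fa z) powr p) T (- cnj a * z)" if z: "norm z < 1" for z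
  proof -
    have d: "1 - cnj w * z = 1 + of_real T * (- cnj a * z)" by (simp add: a(2))
    have nz: "1 - cnj w * z \<noteq> 0" using disc_denominator[OF w z] by (metis less_irrefl zero_complex.sel(1))
    have "a * (- cnj a * z + of_real T) = of_real T * a - (a * cnj a) * z"
      by (simp add: algebra_simps)
    then have "w - z = a * (- cnj a * z + of_real T)"
      unfolding aa a(2)[symmetric] by simp
    then have m: "(w - z) / (1 - cnj w * z) = a * mob T (- cnj a * z)" by (simp add: mob_def d)
    have "norm (T_op w (\<alpha> / p) f z) powr p = norm (?fa (mob T (- cnj a * z))) powr p * (jac T (- cnj a * z) powr (\<alpha> / p)) powr p"
      unfolding norm_T_op[OF w z] m by (simp add: powr_mult jac_def d T_def)
    then show ?thesis using p by (simp add: pull_def powr_powr)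
  qed
  have fan: "continuous_on (ball 0 1) (pull \<alpha> (\<lambda>z. norm (?fa z) powr p) T)"
    by (intro continuous_on_pull1 T cc holomorphic_on_imp_continuous_on fac)
  have "wint \<alpha> (cmean (\<lambda>z. norm (T_op w (\<alpha> / p) f z) powr p)) \<rho>
      = wint \<alpha> (cmean (pull \<alpha> (\<lambda>z. norm (?fa z) powr p) T)) \<rho>"
  proof (rule wint_cong)
    fix r assume r: "0 \<le> r" "r \<le> \<rho>"
    have "cmean (\<lambda>z. norm (T_op w (\<alpha> / p) f z) powr p) r = cmean (\<lambda>z. pull \<alpha> (\<lambda>z. norm (?fa z) powr p) T (- cnj a * z)) r"
      by (rule cmean_cong, rule key) (use r \<rho> in auto)
    also have "\<dots> = cmean (pull \<alpha> (\<lambda>z. norm (?fa z) powr p) T) r"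
      by (rule cmean_rotate[OF fan]) (use r \<rho> a(1) in auto)
    finally show "cmean (\<lambda>z. norm (T_op w (\<alpha> / p) f z) powr p) r = cmean (pull \<alpha> (\<lambda>z. norm (?fa z) powr p) T) r" .
  qed (use \<rho> in auto)
  also have "\<dots> \<le> S"
    by (rule wint_pull_bound[OF \<alpha> p T fac \<rho>]) (simp add: eq1 S)
  finally show ?thesis .
qed

lemma wint_le_A_norm_pow:
  assumes p: "0 < p" and f: "f holomorphic_on ball 0 1" and \<rho>: "0 < \<rho>" "\<rho> < 1"
  shows "ennreal (wint \<alpha> (cmean (\<lambda>z. norm (f z) powr p)) \<rho>) \<le> A_norm_pow \<alpha> p f"
proof -
  obtain n where "1 / real (Suc n) < 1 - \<rho>"
    using reals_Archimedean[of "1 - \<rho>"] \<rho> by (auto simp: divide_inverse)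
  moreover have "1 / real (Suc (Suc n)) \<le> 1 / real (Suc n)" by (intro frac_le) auto
  ultimately have "\<rho> \<le> 1 - 1 / real (Suc (Suc n))" by simp
  then have "wint \<alpha> (cmean (\<lambda>z. norm (f z) powr p)) \<rho> \<le> wint \<alpha> (cmean (\<lambda>z. norm (f z) powr p)) (1 - 1 / real (Suc (Suc n)))"
    using \<rho> by (intro wint_norm_powr_mono p f) auto
  then show ?thesis
    unfolding A_norm_pow_eq_SUP[OF p f] by (intro SUP_upper2[of n] ennreal_leI) auto
qed

lemma A_norm_pow_T_op_le:
  assumes \<alpha>: "0 < \<alpha>" and p: "0 < p" and f: "f holomorphic_on ball 0 1" and w: "norm w < 1"
  shows "A_norm_pow \<alpha> p (T_op w (\<alpha> / p) f) \<le> A_norm_pow \<alpha> p f"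
proof (cases "A_norm_pow \<alpha> p f")
  case (real S)
  have "wint \<alpha> (cmean (\<lambda>z. norm (f z) powr p)) \<tau> \<le> S" if "0 < \<tau>" "\<tau> < 1" for \<tau>
    using wint_le_A_norm_pow[OF p f that, of \<alpha>] real by (simp add: ennreal_le_iff)
  note b = wint_T_op_bound[OF \<alpha> p f w _ _ this]
  show ?thesis
    unfolding A_norm_pow_eq_SUP[OF p T_op_holomorphic[OF w f]] real(2)
    by (intro SUP_least ennreal_leI b) auto
qed simp

theorem theorem1p1:
  fixes \<alpha> p :: real and f :: "complex \<Rightarrow> complex" and w :: complex
  assumes "0 < \<alpha>" and "0 < p"
    and "f \<in> A_space \<alpha> p"
    and "w \<in> ball 0 1"
  shows "T_op w (\<alpha> / p) f \<in> A_space \<alpha> p \<and>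
         A_norm \<alpha> p f = A_norm \<alpha> p (T_op w (\<alpha> / p) f)"
proof -
  let ?g = "T_op w (\<alpha> / p) f"
  have f: "f holomorphic_on ball 0 1" and fin: "A_norm \<alpha> p f < \<infinity>" using assms by (auto simp: A_space_def)
  have w: "norm w < 1" using assms by simp
  have g: "?g holomorphic_on ball 0 1" by (rule T_op_holomorphic[OF w f])
  have "A_norm_pow \<alpha> p f = A_norm_pow \<alpha> p (T_op w (\<alpha> / p) ?g)"
    unfolding A_norm_pow_eq_SUP[OF assms(2) f] A_norm_pow_eq_SUP[OF assms(2) T_op_holomorphic[OF w g]]
  proof (intro SUP_cong refl arg_cong[where f=ennreal] wint_cong cmean_cong)
    fix n r and z :: complex
    assume "0 \<le> r" "r \<le> 1 - 1 / real (Suc (Suc n))" "norm z = \<bar>r\<bar>"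
    moreover have "1 - 1 / real (Suc (Suc n)) < 1" by simp
    ultimately have "norm z < 1" by linarith
    then show "norm (f z) powr p = norm (T_op w (\<alpha> / p) ?g z) powr p"
      by (simp add: norm_T_op_T_op[OF w])
  qed simp
  also have "\<dots> \<le> A_norm_pow \<alpha> p ?g" by (rule A_norm_pow_T_op_le[OF assms(1,2) g w])
  finally have "A_norm_pow \<alpha> p f = A_norm_pow \<alpha> p ?g"
    using A_norm_pow_T_op_le[OF assms(1,2) f w] by (rule antisym)
  then have eq: "A_norm \<alpha> p f = A_norm \<alpha> p ?g" by (simp add: A_norm_def)
  then show ?thesis using fin g by (simp add: A_space_def)
qed

end
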